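(* Let $\tau>0$, let $\beta>0$ be a real constant, let $V\in L^\infty(\mathcal D)$ with $V\ge0$, and let $\kappa\ge\|V\|_\infty+3\beta M^2$. Let $\phi^0\in L^2(\mathcal D)$ with $\|\phi^0\|_2=1$, and let $(\phi^n)_{n\ge0}$ be generated by $$\phi^{n+1}=\frac{\frac1\tau e^{\tau\Delta}\phi^n-2V\phi^n-\frac\beta2\widetilde f(\phi^n)+2\kappa\phi^n}{\Big\|\frac1\tau e^{\tau\Delta}\phi^n-2V\phi^n-\frac\beta2\widetilde f(\phi^n)+2\kappa\phi^n\Big\|_2},\qquad n\ge0.$$ Then $$\widetilde E^{1,\tau}(\phi^{n+1})\le\widetilde E^{1,\tau}(\phi^n),\qquad n\ge0.$$
   Context: $\mathcal D\subset\mathbb R^d$, $d\in\{1,2,3\}$, is a bounded domain (an interval for $d=1$, a rectangle for $d=2$, a box for $d=3$), with periodic boundary conditions imposed on all functions. Functions are complex-valued; $\|\cdot\|_2$, $\|\cdot\|_\infty$ are the norms of $L^2(\mathcal D)$, $L^\infty(\mathcal D)$. $e^{t\Delta}$, $t\ge 0$, denotes the heat semigroup on $L^2(\mathcal D)$ generated by the Laplacian with periodic boundary conditions. Let $$M=\sqrt{\frac{\beta+2\int_{\mathcal D}V(x)\,dx}{\beta|\mathcal D|}},$$ where $|\mathcal D|$ is the Lebesgue measure of $\mathcal D$. The truncated nonlinearity and its derivative are $$\widetilde F(\phi)=\begin{cases}|\phi|^4,&|\phi|\le M,\\ 6M^2|\phi|^2-8M^3|\phi|+3M^4,&|\phi|>M,\end{cases}\qquad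 \widetilde f(\phi)=\begin{cases}4|\phi|^2\phi,&|\phi|\le M,\\ 12M^2\phi-8M^3\frac{\phi}{|\phi|},&|\phi|>M.\end{cases}$$ The truncated energy is $$\widetilde E^{1,\tau}(\phi)=\frac1{2\tau}+\int_{\mathcal D}\Big(-\frac1{2\tau}\big|e^{\frac\tau2\Delta}\phi\big|^2+V(x)|\phi|^2+\frac\beta2\widetilde F(\phi)-\kappa|\phi|^2\Big)\,dx+\kappa.$$ *)

theory Defs
  imports "HOL-Analysis.Analysis" "HOL-Probability.Essential_Supremum"
begin

section \<open>Lebesgue spaces\<close>

text \<open>Elements of \<open>L\<^sup>2(D)\<close> and \<open>L\<^sup>\<infinity>(D)\<close> are represented by functions on the whole space;
  only their values almost everywhere on \<open>D\<close> matter.\<close>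

definition L2 :: "'a::euclidean_space set \<Rightarrow> ('a \<Rightarrow> complex) set" where
  "L2 D = {u. u \<in> borel_measurable (lebesgue_on D) \<and>
              integrable (lebesgue_on D) (\<lambda>x. (norm (u x))\<^sup>2)}"

definition L2_norm :: "'a::euclidean_space set \<Rightarrow> ('a \<Rightarrow> complex) \<Rightarrow> real" where
  "L2_norm D u = sqrt (LINT x|lebesgue_on D. (norm (u x))\<^sup>2)"

definition Linfty :: "'a::euclidean_space set \<Rightarrow> ('a \<Rightarrow> real) set" where
  "Linfty D = {V. V \<in> borel_measurable (lebesgue_on D) \<and>
                  esssup (lebesgue_on D) (\<lambda>x. ereal \<bar>V x\<bar>) < \<infinity>}"

definition Linfty_norm :: "'a::euclidean_space set \<Rightarrow> ('a \<Rightarrow> real) \<Rightarrow> real" where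
  "Linfty_norm D V = real_of_ereal (esssup (lebesgue_on D) (\<lambda>x. ereal \<bar>V x\<bar>))"


section \<open>The Laplacian with periodic boundary conditions\<close>

definition partial_deriv :: "'a::euclidean_space \<Rightarrow> ('a \<Rightarrow> complex) \<Rightarrow> 'a \<Rightarrow> complex" where
  "partial_deriv i f x = vector_derivative (\<lambda>s. f (x + s *\<^sub>R i)) (at 0)"

primrec C_k :: "nat \<Rightarrow> ('a::euclidean_space \<Rightarrow> complex) \<Rightarrow> bool" where
  "C_k 0 f \<longleftrightarrow> continuous_on UNIV f"
| "C_k (Suc k) f \<longleftrightarrow> continuous_on UNIV f \<and>
     (\<forall>i\<in>Basis. (\<forall>x. (\<lambda>s::real. f (x + s *\<^sub>R i)) differentiable (at 0)) \<and>
                C_k k (partial_deriv i f))"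

definition laplacian :: "('a::euclidean_space \<Rightarrow> complex) \<Rightarrow> 'a \<Rightarrow> complex" where
  "laplacian f x = (\<Sum>i\<in>Basis. partial_deriv i (partial_deriv i f) x)"

definition smooth_periodic :: "'a::euclidean_space \<Rightarrow> 'a \<Rightarrow> ('a \<Rightarrow> complex) \<Rightarrow> bool" where
  "smooth_periodic a b f \<longleftrightarrow> (\<forall>k. C_k k f) \<and>
     (\<forall>i\<in>Basis. \<forall>x. f (x + ((b - a) \<bullet> i) *\<^sub>R i) = f x)"

text \<open>The self-adjoint periodic Laplacian on \<open>L\<^sup>2\<close> of the box \<open>(a, b)\<close>, given by its graph: the
  closure in \<open>L\<^sup>2 \<times> L\<^sup>2\<close> of the classical Laplacian on smooth periodic functions. Its domain is
  the periodic Sobolev space of order two.\<close>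

definition periodic_laplacian ::
  "'a::euclidean_space \<Rightarrow> 'a \<Rightarrow> ('a \<Rightarrow> complex) \<Rightarrow> ('a \<Rightarrow> complex) \<Rightarrow> bool" where
  "periodic_laplacian a b u g \<longleftrightarrow> u \<in> L2 (box a b) \<and> g \<in> L2 (box a b) \<and>
     (\<exists>\<psi>::nat \<Rightarrow> 'a \<Rightarrow> complex. (\<forall>m. smooth_periodic a b (\<psi> m)) \<and>
        (\<lambda>m. L2_norm (box a b) (\<lambda>x. \<psi> m x - u x)) \<longlonglongrightarrow> 0 \<and>
        (\<lambda>m. L2_norm (box a b) (\<lambda>x. laplacian (\<psi> m) x - g x)) \<longlonglongrightarrow> 0)"


section \<open>The heat semigroup\<close>

text \<open>Strongly continuous semigroups of bounded linear operators on \<open>L\<^sup>2(D)\<close>. Identities hold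
  almost everywhere; that the operators respect equality almost everywhere is a consequence of
  linearity and boundedness.\<close>

definition C0_semigroup ::
  "'a::euclidean_space set \<Rightarrow> (real \<Rightarrow> ('a \<Rightarrow> complex) \<Rightarrow> 'a \<Rightarrow> complex) \<Rightarrow> bool" where
  "C0_semigroup D T \<longleftrightarrow>
     (\<forall>t\<ge>0. \<forall>u\<in>L2 D. T t u \<in> L2 D) \<and>
     (\<forall>t\<ge>0. \<forall>u\<in>L2 D. \<forall>v\<in>L2 D. \<forall>c.
        AE x in lebesgue_on D. T t (\<lambda>y. c * u y + v y) x = c * T t u x + T t v x) \<and>
     (\<forall>t\<ge>0. \<exists>C. \<forall>u\<in>L2 D. L2_norm D (T t u) \<le> C * L2_norm D u) \<and>
     (\<forall>u\<in>L2 D. AE x in lebesgue_on D. T 0 u x = u x) \<and>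
     (\<forall>s\<ge>0. \<forall>t\<ge>0. \<forall>u\<in>L2 D. AE x in lebesgue_on D. T (s + t) u x = T s (T t u) x) \<and>
     (\<forall>u\<in>L2 D. ((\<lambda>t. L2_norm D (\<lambda>x. T t u x - u x)) \<longlongrightarrow> 0) (at_right 0))"

text \<open>The graph of the infinitesimal generator.\<close>

definition generator ::
  "'a::euclidean_space set \<Rightarrow> (real \<Rightarrow> ('a \<Rightarrow> complex) \<Rightarrow> 'a \<Rightarrow> complex) \<Rightarrow>
   ('a \<Rightarrow> complex) \<Rightarrow> ('a \<Rightarrow> complex) \<Rightarrow> bool" where
  "generator D T u g \<longleftrightarrow> u \<in> L2 D \<and> g \<in> L2 D \<and>
     ((\<lambda>h. L2_norm D (\<lambda>x. (T h u x - u x) / complex_of_real h - g x)) \<longlongrightarrow> 0) (at_right 0)"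

text \<open>\<open>T t u\<close> is (a representative of) \<open>e\<^sup>t\<^sup>\<Delta> u\<close>.\<close>

definition heat_semigroup ::
  "'a::euclidean_space \<Rightarrow> 'a \<Rightarrow> (real \<Rightarrow> ('a \<Rightarrow> complex) \<Rightarrow> 'a \<Rightarrow> complex) \<Rightarrow> bool" where
  "heat_semigroup a b T \<longleftrightarrow> C0_semigroup (box a b) T \<and>
     (\<forall>u g. generator (box a b) T u g \<longleftrightarrow> periodic_laplacian a b u g)"


section \<open>Truncated nonlinearity and energy\<close>

definition trunc_M :: "'a::euclidean_space set \<Rightarrow> real \<Rightarrow> ('a \<Rightarrow> real) \<Rightarrow> real" where
  "trunc_M D \<beta> V = sqrt ((\<beta> + 2 * (LINT x|lebesgue_on D. V x)) / (\<beta> * measure lebesgue D))"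

definition trunc_F :: "real \<Rightarrow> complex \<Rightarrow> real" where
  "trunc_F M z = (if norm z \<le> M then norm z ^ 4
                  else 6 * M\<^sup>2 * (norm z)\<^sup>2 - 8 * M ^ 3 * norm z + 3 * M ^ 4)"

definition trunc_f :: "real \<Rightarrow> complex \<Rightarrow> complex" where
  "trunc_f M z = (if norm z \<le> M then 4 * complex_of_real ((norm z)\<^sup>2) * z
                  else 12 * complex_of_real (M\<^sup>2) * z
                       - 8 * complex_of_real (M ^ 3) * (z / complex_of_real (norm z)))"

definition trunc_energy ::
  "'a::euclidean_space set \<Rightarrow> (real \<Rightarrow> ('a \<Rightarrow> complex) \<Rightarrow> 'a \<Rightarrow> complex) \<Rightarrow>
   ('a \<Rightarrow> real) \<Rightarrow> real \<Rightarrow> real \<Rightarrow> real \<Rightarrow> ('a \<Rightarrow> complex) \<Rightarrow> real" where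
  "trunc_energy D T V \<beta> \<kappa> \<tau> u =
     1 / (2 * \<tau>)
     + (LINT x|lebesgue_on D.
          - (1 / (2 * \<tau>)) * (norm (T (\<tau> / 2) u x))\<^sup>2 + V x * (norm (u x))\<^sup>2
          + \<beta> / 2 * trunc_F (trunc_M D \<beta> V) (u x) - \<kappa> * (norm (u x))\<^sup>2)
     + \<kappa>"

text \<open>The iterate before normalization.\<close>

definition pre_iterate ::
  "'a::euclidean_space set \<Rightarrow> (real \<Rightarrow> ('a \<Rightarrow> complex) \<Rightarrow> 'a \<Rightarrow> complex) \<Rightarrow>
   ('a \<Rightarrow> real) \<Rightarrow> real \<Rightarrow> real \<Rightarrow> real \<Rightarrow> ('a \<Rightarrow> complex) \<Rightarrow> 'a \<Rightarrow> complex" where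
  "pre_iterate D T V \<beta> \<kappa> \<tau> u x =
     complex_of_real (1 / \<tau>) * T \<tau> u x - 2 * complex_of_real (V x) * u x
     - complex_of_real (\<beta> / 2) * trunc_f (trunc_M D \<beta> V) (u x)
     + 2 * complex_of_real \<kappa> * u x"

end

theory Submission
  imports Defs
begin

text \<open>
  Write \<open>E\<close> for the truncated energy and \<open>g\<close> for the iterate before normalization that belongs to \<open>u\<close>.
  The energy is concave on \<open>L\<^sup>2\<close>, and \<open>- g\<close> is its gradient at \<open>u\<close>, so
  \<open>E(v) - E(u) \<le> - Re \<langle>g, v - u\<rangle>\<close> for every \<open>v\<close>. The next iterate \<open>v = g / \<parallel>g\<parallel>\<close> maximizes
  \<open>Re \<langle>g, \<cdot>\<rangle>\<close> over the unit ball, which contains \<open>u\<close>; hence the right side is nonpositive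
  (\<open>trunc_energy_descent\<close>). If \<open>g\<close> is null, division by zero makes the next iterate null, and the
  argument survives because it only uses \<open>\<parallel>u\<parallel> \<le> 1\<close>.

  Concavity has two sources. The nonlinearity \<open>F\<close> continues \<open>r\<^sup>4\<close> quadratically beyond \<open>M\<close>, so its Hessian
  is at most \<open>12 M\<^sup>2\<close> (\<open>trunc_F_upper_quadratic\<close>), and \<open>\<kappa> \<ge> \<parallel>V\<parallel> + 3 \<beta> M\<^sup>2\<close> makes
  \<open>V \<bar>z\<bar>\<^sup>2 + \<beta>/2 F(z) - \<kappa> \<bar>z\<bar>\<^sup>2\<close> concave in \<open>z\<close> (\<open>potential_density_tangent\<close>). The heat part is minus a
  square, and its gradient is \<open>- e\<^sup>\<tau>\<^sup>\<Delta> u / \<tau>\<close> because the heat semigroup is symmetric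
  (\<open>heat_energy_lower\<close>).

  Symmetry (\<open>heat_semigroup_symmetric\<close>) has to be extracted from the description of the semigroup by its
  generator. The characters \<open>e\<^sup>i\<^sup>\<omega>\<^sup>\<cdot>\<^sup>x\<close> of the periodic box are eigenvectors of the Laplacian, hence
  eigenvectors of the semigroup with real eigenvalues (\<open>C0_semigroup_eigenvector\<close>). They are orthogonal
  (\<open>character_orthogonal\<close>) and their span is dense (\<open>closed_subspace_characters_eq_L2\<close>), so symmetry follows
  by continuity. Passing from the generator to the semigroup requires a bound on the operators that is
  uniform for small times; it comes from completeness of \<open>L\<^sup>2\<close> and the principle of uniform boundedness.
\<close>

section \<open>The space of square integrable functions\<close>

lemma L2_measurable: "u \<in> L2 D \<Longrightarrow> u \<in> borel_measurable (lebesgue_on D)"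
  by (simp add: L2_def)

lemma L2_integrable_norm_sq: "u \<in> L2 D \<Longrightarrow> integrable (lebesgue_on D) (\<lambda>x. (norm (u x))\<^sup>2)"
  by (simp add: L2_def)

text \<open>Square integrability is always obtained in this way, from measurability and an integrable
  bound on \<open>\<bar>u\<bar>\<^sup>2\<close>.\<close>
lemma L2_dominated:
  assumes "u \<in> borel_measurable (lebesgue_on D)" "integrable (lebesgue_on D) w"
    and "AE x in lebesgue_on D. (norm (u x))\<^sup>2 \<le> w x"
  shows "u \<in> L2 D"
  unfolding L2_def
proof (intro CollectI conjI)
  show "integrable (lebesgue_on D) (\<lambda>x. (norm (u x))\<^sup>2)"
    by (rule Bochner_Integration.integrable_bound[OF assms(2)])
       (use assms in \<open>auto intro: measurable_compose elim!: eventually_mono\<close>)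
qed (fact assms)

lemma norm_add_sq_le: "(norm (x + y))\<^sup>2 \<le> 2 * (norm x)\<^sup>2 + 2 * (norm (y :: 'b::real_normed_vector))\<^sup>2"
proof -
  have "(norm (x + y))\<^sup>2 \<le> (norm x + norm y)\<^sup>2"
    by (simp add: norm_triangle_ineq power_mono)
  also have "\<dots> \<le> 2 * (norm x)\<^sup>2 + 2 * (norm y)\<^sup>2"
    using sum_squares_ge_zero[of "norm x - norm y" 0] by (simp add: power2_eq_square algebra_simps)
  finally show ?thesis .
qed

lemma L2_lincomb:
  assumes "u \<in> L2 D" "v \<in> L2 D"
  shows "(\<lambda>x. c * u x + v x) \<in> L2 D"
proof (rule L2_dominated)
  show "(\<lambda>x. c * u x + v x) \<in> borel_measurable (lebesgue_on D)"
    using assms[THEN L2_measurable] by measurable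
  show "integrable (lebesgue_on D) (\<lambda>x. 2 * ((norm c)\<^sup>2 * (norm (u x))\<^sup>2) + 2 * (norm (v x))\<^sup>2)"
    using assms[THEN L2_integrable_norm_sq] by auto
  show "AE x in lebesgue_on D. (norm (c * u x + v x))\<^sup>2
          \<le> 2 * ((norm c)\<^sup>2 * (norm (u x))\<^sup>2) + 2 * (norm (v x))\<^sup>2"
    using norm_add_sq_le[of "c * u x" "v x" for x] by (simp add: norm_mult power_mult_distrib)
qed

lemma L2_zero: "(\<lambda>x. 0) \<in> L2 D"
  by (simp add: L2_def)

lemma L2_cmult: "u \<in> L2 D \<Longrightarrow> (\<lambda>x. c * u x) \<in> L2 D"
  using L2_lincomb[OF _ L2_zero] by simp

lemma L2_add: "u \<in> L2 D \<Longrightarrow> v \<in> L2 D \<Longrightarrow> (\<lambda>x. u x + v x) \<in> L2 D"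
  using L2_lincomb[of u D v 1] by simp

lemma L2_diff: "u \<in> L2 D \<Longrightarrow> v \<in> L2 D \<Longrightarrow> (\<lambda>x. u x - v x) \<in> L2 D"
  using L2_lincomb[of v D u "-1"] by simp

lemma L2_sum: "(\<And>i. i \<in> I \<Longrightarrow> u i \<in> L2 D) \<Longrightarrow> (\<lambda>x. \<Sum>i\<in>I. u i x) \<in> L2 D"
  by (induction I rule: infinite_finite_induct) (auto intro: L2_zero L2_add)

text \<open>Lebesgue measure is complete, so measurability passes to any function that agrees almost
  everywhere. This matters because iterates and semigroup identities are only known up to null sets.\<close>
lemma L2_AE_cong:
  fixes u :: "'a::euclidean_space \<Rightarrow> complex"
  assumes "D \<in> sets lebesgue" "u \<in> L2 D" "AE x in lebesgue_on D. v x = u x"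
  shows "v \<in> L2 D"
proof -
  have "(\<lambda>x. indicator D x *\<^sub>R u x) \<in> borel_measurable lebesgue"
    using L2_measurable[OF assms(2)] assms(1) by (simp add: borel_measurable_restrict_space_iff)
  moreover have "AE x in lebesgue. indicator D x *\<^sub>R u x = indicator D x *\<^sub>R v x"
    using assms(3,1) by (subst (asm) AE_restrict_space_iff) (auto elim!: eventually_mono simp: indicator_def)
  ultimately have "(\<lambda>x. indicator D x *\<^sub>R v x) \<in> borel_measurable lebesgue"
    by (rule borel_measurable_AE)
  then have "v \<in> borel_measurable (lebesgue_on D)"
    using assms(1) by (simp add: borel_measurable_restrict_space_iff)
  then show ?thesis
    by (rule L2_dominated[OF _ L2_integrable_norm_sq[OF assms(2)]])
       (use assms(3) in \<open>auto elim!: eventually_mono\<close>)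
qed

section \<open>The inner product\<close>

definition L2_inner :: "'a::euclidean_space set \<Rightarrow> ('a \<Rightarrow> complex) \<Rightarrow> ('a \<Rightarrow> complex) \<Rightarrow> complex" where
  "L2_inner D u v = (LINT x|lebesgue_on D. u x * cnj (v x))"

lemma L2_inner_integrable:
  assumes "u \<in> L2 D" "v \<in> L2 D"
  shows "integrable (lebesgue_on D) (\<lambda>x. u x * cnj (v x))"
proof (rule Bochner_Integration.integrable_bound)
  show "integrable (lebesgue_on D) (\<lambda>x. (norm (u x))\<^sup>2 + (norm (v x))\<^sup>2)"
    using assms[THEN L2_integrable_norm_sq] by simp
  have cnj: "cnj \<in> borel_measurable borel"
    by (intro borel_measurable_continuous_onI continuous_on_cnj continuous_on_id)
  show "(\<lambda>x. u x * cnj (v x)) \<in> borel_measurable (lebesgue_on D)"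
    by (rule borel_measurable_times[OF L2_measurable[OF assms(1)]
          measurable_compose[OF L2_measurable[OF assms(2)] cnj]])
  have *: "p * q \<le> p\<^sup>2 + q\<^sup>2" for p q :: real
    using sum_squares_bound[of p q] zero_le_power2[of p] zero_le_power2[of q] by linarith
  show "AE x in lebesgue_on D. norm (u x * cnj (v x)) \<le> norm ((norm (u x))\<^sup>2 + (norm (v x))\<^sup>2)"
    by (auto simp: norm_mult *)
qed

lemma L2_inner_lincomb_left:
  assumes "u \<in> L2 D" "v \<in> L2 D" "w \<in> L2 D"
  shows "L2_inner D (\<lambda>x. c * u x + v x) w = c * L2_inner D u w + L2_inner D v w"
proof -
  have "L2_inner D (\<lambda>x. c * u x + v x) w
      = (LINT x|lebesgue_on D. c * (u x * cnj (w x)) + v x * cnj (w x))"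
    unfolding L2_inner_def by (simp add: algebra_simps)
  also have "\<dots> = c * L2_inner D u w + L2_inner D v w"
    unfolding L2_inner_def
    using L2_inner_integrable[OF assms(1,3)] L2_inner_integrable[OF assms(2,3)] by simp
  finally show ?thesis .
qed

lemma L2_inner_diff_left:
  assumes "u \<in> L2 D" "v \<in> L2 D" "w \<in> L2 D"
  shows "L2_inner D (\<lambda>x. u x - v x) w = L2_inner D u w - L2_inner D v w"
  using L2_inner_lincomb_left[OF assms(2,1,3), of "-1"] by simp

lemma L2_inner_commute: "L2_inner D v u = cnj (L2_inner D u v)"
  unfolding L2_inner_def by (subst Bochner_Integration.integral_cnj[symmetric]) (simp add: mult.commute)

lemma L2_inner_cong:
  assumes "AE x in lebesgue_on D. u x = u' x" "u \<in> L2 D" "u' \<in> L2 D" "v \<in> L2 D"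
  shows "L2_inner D u v = L2_inner D u' v"
  unfolding L2_inner_def
  by (rule integral_cong_AE)
     (use assms(1) L2_inner_integrable[OF assms(2,4)] L2_inner_integrable[OF assms(3,4)]
       in \<open>auto elim!: eventually_mono\<close>)

lemma L2_norm_nonneg: "0 \<le> L2_norm D u"
  by (simp add: L2_norm_def)

lemma L2_norm_power2: "(L2_norm D u)\<^sup>2 = (LINT x|lebesgue_on D. (norm (u x))\<^sup>2)"
  by (simp add: L2_norm_def)

lemma L2_inner_self: "L2_inner D u u = complex_of_real ((L2_norm D u)\<^sup>2)"
  unfolding L2_inner_def L2_norm_power2
  by (subst integral_complex_of_real[symmetric])
     (simp only: complex_norm_square)

lemma L2_norm_cmult: "L2_norm D (\<lambda>x. c * u x) = norm c * L2_norm D u"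
  by (simp add: L2_norm_def norm_mult power_mult_distrib real_sqrt_mult)

lemma L2_norm_minus_commute: "L2_norm D (\<lambda>x. u x - v x) = L2_norm D (\<lambda>x. v x - u x)"
  by (simp add: L2_norm_def norm_minus_commute)

lemma L2_norm_cong:
  assumes "AE x in lebesgue_on D. u x = v x" "u \<in> L2 D" "v \<in> L2 D"
  shows "L2_norm D u = L2_norm D v"
  unfolding L2_norm_def
  by (rule arg_cong[where f=sqrt], rule integral_cong_AE)
     (use assms(2,3)[THEN L2_integrable_norm_sq] assms(1) in \<open>auto elim!: eventually_mono\<close>)

lemma L2_norm_eq_0_AE:
  assumes "u \<in> L2 D" "L2_norm D u = 0"
  shows "AE x in lebesgue_on D. u x = 0"
  using integral_nonneg_eq_0_iff_AE[OF L2_integrable_norm_sq[OF assms(1)]] assms(2)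
  by (simp add: L2_norm_def)

text \<open>Expanding \<open>\<parallel>s u - t v\<parallel>\<^sup>2 \<ge> 0\<close> gives a quadratic inequality in the real numbers \<open>s, t\<close>. If both norms are
  positive, \<open>s = \<parallel>v\<parallel>\<close> and \<open>t = \<parallel>u\<parallel>\<close> is the sharp choice; if one of them vanishes, letting the parameter
  in front of that function grow forces the left side to be nonpositive.\<close>
lemma Re_L2_inner_le:
  assumes u: "u \<in> L2 D" and v: "v \<in> L2 D"
  shows "Re (L2_inner D u v) \<le> L2_norm D u * L2_norm D v"
proof -
  define p q where "p = L2_norm D u" and "q = L2_norm D v"
  have pq: "0 \<le> p" "0 \<le> q"
    by (auto simp: p_def q_def L2_norm_nonneg)
  have ineq: "2 * s * t * Re (L2_inner D u v) \<le> s\<^sup>2 * p\<^sup>2 + t\<^sup>2 * q\<^sup>2" for s t :: real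
  proof -
    have "0 \<le> (LINT x|lebesgue_on D. (norm (s *\<^sub>R u x - t *\<^sub>R v x))\<^sup>2)"
      by simp
    also have "\<dots> = (LINT x|lebesgue_on D. s\<^sup>2 * (norm (u x))\<^sup>2 + t\<^sup>2 * (norm (v x))\<^sup>2
                       - 2 * s * t * Re (u x * cnj (v x)))"
      by (rule Bochner_Integration.integral_cong[OF refl])
         (simp only: cmod_power2; simp add: power2_eq_square algebra_simps)
    also have "\<dots> = s\<^sup>2 * p\<^sup>2 + t\<^sup>2 * q\<^sup>2 - 2 * s * t * Re (L2_inner D u v)"
      unfolding p_def q_def L2_norm_power2 L2_inner_def
      using u[THEN L2_integrable_norm_sq] v[THEN L2_integrable_norm_sq] L2_inner_integrable[OF u v]
      by (simp del: complex_cnj times_complex.sel)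
    finally show ?thesis
      by simp
  qed
  show ?thesis
  proof (cases "p = 0 \<or> q = 0")
    case True
    have "Re (L2_inner D u v) \<le> 0"
    proof (rule ccontr)
      assume "\<not> ?thesis"
      then have pos: "0 < Re (L2_inner D u v)" by simp
      define r where "r = Re (L2_inner D u v)"
      show False
        using True
      proof
        assume "p = 0"
        with ineq[of "(q\<^sup>2 + 1) / r" 1] pos have "q\<^sup>2 + 2 \<le> 0"
          by (simp add: r_def)
        then show False
          using zero_le_power2[of q] by linarith
      next
        assume "q = 0"
        with ineq[of 1 "(p\<^sup>2 + 1) / r"] pos have "p\<^sup>2 + 2 \<le> 0"
          by (simp add: r_def)
        then show False
          using zero_le_power2[of p] by linarith
      qed
    qed
    with True show ?thesis by (auto simp: p_def q_def)
  next
    case False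
    then have pos: "0 < p * q" using pq by auto
    have "(p * q) * Re (L2_inner D u v) \<le> (p * q) * (p * q)"
      using ineq[of q p] by (simp add: power2_eq_square algebra_simps)
    then show ?thesis
      using pos unfolding p_def q_def by (rule mult_left_le_imp_le)
  qed
qed

text \<open>Multiplying \<open>u\<close> by a unimodular constant makes the inner product real and nonnegative, which
  reduces the bound to its real part.\<close>
lemma L2_Cauchy_Schwarz:
  assumes u: "u \<in> L2 D" and v: "v \<in> L2 D"
  shows "norm (L2_inner D u v) \<le> L2_norm D u * L2_norm D v"
proof -
  define z where "z = L2_inner D u v"
  define c where "c = (if z = 0 then 1 else cnj (sgn z))"
  have c: "norm c = 1"
    by (simp add: c_def norm_sgn)
  have "L2_inner D (\<lambda>x. c * u x) v = c * z"
    unfolding z_def using L2_inner_lincomb_left[OF u L2_zero v, of c]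
    by (simp add: L2_inner_def)
  also have "\<dots> = of_real (norm z)"
  proof (cases "z = 0")
    case False
    have "cnj (sgn z) * z = of_real (norm z)"
      using False complex_norm_square[of z]
      by (simp add: sgn_eq divide_simps power2_eq_square mult.commute)
    then show ?thesis using False by (simp add: c_def)
  qed simp
  finally have "Re (L2_inner D (\<lambda>x. c * u x) v) = norm z"
    by simp
  moreover have "Re (L2_inner D (\<lambda>x. c * u x) v) \<le> L2_norm D (\<lambda>x. c * u x) * L2_norm D v"
    by (rule Re_L2_inner_le[OF L2_cmult[OF u] v])
  ultimately show ?thesis
    by (simp add: L2_norm_cmult c z_def)
qed

lemma L2_norm_add_power2:
  assumes u: "u \<in> L2 D" and v: "v \<in> L2 D"
  shows "(L2_norm D (\<lambda>x. u x + v x))\<^sup>2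
           = (L2_norm D u)\<^sup>2 + 2 * Re (L2_inner D u v) + (L2_norm D v)\<^sup>2"
proof -
  have "(L2_norm D (\<lambda>x. u x + v x))\<^sup>2 = (LINT x|lebesgue_on D. (norm (u x))\<^sup>2
           + 2 * Re (u x * cnj (v x)) + (norm (v x))\<^sup>2)"
    unfolding L2_norm_power2
    by (rule Bochner_Integration.integral_cong[OF refl])
       (simp only: cmod_power2; simp add: power2_eq_square algebra_simps)
  also have "\<dots> = (L2_norm D u)\<^sup>2 + 2 * Re (L2_inner D u v) + (L2_norm D v)\<^sup>2"
    unfolding L2_norm_power2 L2_inner_def
    using u[THEN L2_integrable_norm_sq] v[THEN L2_integrable_norm_sq] L2_inner_integrable[OF u v]
    by (simp del: complex_cnj times_complex.sel)
  finally show ?thesis .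
qed

lemma L2_norm_triangle:
  assumes u: "u \<in> L2 D" and v: "v \<in> L2 D"
  shows "L2_norm D (\<lambda>x. u x + v x) \<le> L2_norm D u + L2_norm D v"
proof (rule power2_le_imp_le)
  show "(L2_norm D (\<lambda>x. u x + v x))\<^sup>2 \<le> (L2_norm D u + L2_norm D v)\<^sup>2"
    using Re_L2_inner_le[OF u v] by (simp add: L2_norm_add_power2[OF u v] power2_sum)
qed (simp add: L2_norm_nonneg)

lemma L2_norm_triangle_diff:
  assumes u: "u \<in> L2 D" and v: "v \<in> L2 D" and w: "w \<in> L2 D"
  shows "L2_norm D (\<lambda>x. u x - w x) \<le> L2_norm D (\<lambda>x. u x - v x) + L2_norm D (\<lambda>x. v x - w x)"
  using L2_norm_triangle[OF L2_diff[OF u v] L2_diff[OF v w]] by simp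

lemma L2_norm_sum_le:
  assumes "\<And>i. i \<in> I \<Longrightarrow> u i \<in> L2 D"
  shows "L2_norm D (\<lambda>x. \<Sum>i\<in>I. u i x) \<le> (\<Sum>i\<in>I. L2_norm D (u i))"
  using assms
proof (induction I rule: infinite_finite_induct)
  case (insert i I)
  then have "L2_norm D (\<lambda>x. u i x + (\<Sum>i\<in>I. u i x)) \<le> L2_norm D (u i) + L2_norm D (\<lambda>x. \<Sum>i\<in>I. u i x)"
    by (intro L2_norm_triangle L2_sum) auto
  with insert show ?case by simp
qed (simp_all add: L2_norm_def)

section \<open>Convergence and completeness\<close>

text \<open>The bound is imposed on \<open>\<bar>u\<^sub>n\<bar>\<^sup>2\<close>, so that Lebesgue's theorem applies to
  \<open>\<bar>u\<^sub>n - v\<bar>\<^sup>2 \<le> 4 w\<close>.\<close>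
lemma L2_dominated_convergence:
  assumes u: "\<And>n. u n \<in> borel_measurable (lebesgue_on D)" and v: "v \<in> borel_measurable (lebesgue_on D)"
    and w: "integrable (lebesgue_on D) w"
    and lim: "AE x in lebesgue_on D. (\<lambda>n. u n x) \<longlonglongrightarrow> v x"
    and bound: "\<And>n. AE x in lebesgue_on D. (norm (u n x))\<^sup>2 \<le> w x"
  shows "\<And>n. u n \<in> L2 D" and "v \<in> L2 D" and "(\<lambda>n. L2_norm D (\<lambda>x. u n x - v x)) \<longlonglongrightarrow> 0"
proof -
  have boundAll: "AE x in lebesgue_on D. \<forall>n. (norm (u n x))\<^sup>2 \<le> w x"
    using bound by (simp add: AE_all_countable)
  have vbound: "AE x in lebesgue_on D. (norm (v x))\<^sup>2 \<le> w x"
    using lim boundAll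
  proof eventually_elim
    case (elim x)
    have "(\<lambda>n. (norm (u n x))\<^sup>2) \<longlonglongrightarrow> (norm (v x))\<^sup>2"
      using elim(1) by (intro tendsto_intros)
    then show ?case
      using elim(2) by (intro LIMSEQ_le_const2) auto
  qed
  show "u n \<in> L2 D" for n
    by (rule L2_dominated[OF u w bound])
  show "v \<in> L2 D"
    by (rule L2_dominated[OF v w vbound])
  have "(\<lambda>n. LINT x|lebesgue_on D. (norm (u n x - v x))\<^sup>2) \<longlonglongrightarrow> (LINT x|lebesgue_on D. 0)"
  proof (rule integral_dominated_convergence)
    show "integrable (lebesgue_on D) (\<lambda>x. 4 * w x)"
      using w by simp
    show "AE x in lebesgue_on D. (\<lambda>n. (norm (u n x - v x))\<^sup>2) \<longlonglongrightarrow> 0"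
      using lim
    proof eventually_elim
      case (elim x)
      then have "(\<lambda>n. (norm (u n x - v x))\<^sup>2) \<longlonglongrightarrow> (norm (v x - v x))\<^sup>2"
        by (intro tendsto_intros)
      then show ?case by simp
    qed
    show "AE x in lebesgue_on D. norm ((norm (u n x - v x))\<^sup>2) \<le> 4 * w x" for n
      using bound[of n] vbound
    proof eventually_elim
      case (elim x)
      then show ?case using norm_add_sq_le[of "u n x" "- v x"] by simp
    qed
    show "(\<lambda>x. (norm (u n x - v x))\<^sup>2) \<in> borel_measurable (lebesgue_on D)" for n
      using u[of n] v by measurable
  qed simp
  then have "(\<lambda>n. sqrt (LINT x|lebesgue_on D. (norm (u n x - v x))\<^sup>2)) \<longlonglongrightarrow> sqrt 0"
    by (intro tendsto_real_sqrt) simp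
  then show "(\<lambda>n. L2_norm D (\<lambda>x. u n x - v x)) \<longlonglongrightarrow> 0"
    by (simp add: L2_norm_def)
qed

lemma L2_norm_tendsto:
  assumes "\<And>n. u n \<in> L2 D" "v \<in> L2 D" "(\<lambda>n. L2_norm D (\<lambda>x. u n x - v x)) \<longlonglongrightarrow> 0"
  shows "(\<lambda>n. L2_norm D (u n)) \<longlonglongrightarrow> L2_norm D v"
proof -
  have "norm (L2_norm D (u n) - L2_norm D v) \<le> L2_norm D (\<lambda>x. u n x - v x)" for n
    using L2_norm_triangle[OF L2_diff[OF assms(1)[of n] assms(2)] assms(2)]
      L2_norm_triangle[OF L2_diff[OF assms(2) assms(1)[of n]] assms(1)[of n]]
      L2_norm_minus_commute[of D v "u n"]
    by (simp add: abs_le_iff)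
  then have "(\<lambda>n. L2_norm D (u n) - L2_norm D v) \<longlonglongrightarrow> 0"
    by (intro Lim_null_comparison[OF _ assms(3)]) simp
  then show ?thesis by (simp add: LIM_zero_iff)
qed

lemma L2_inner_tendsto:
  assumes "\<And>n. u n \<in> L2 D" "v \<in> L2 D" "w \<in> L2 D" "(\<lambda>n. L2_norm D (\<lambda>x. u n x - v x)) \<longlonglongrightarrow> 0"
  shows "(\<lambda>n. L2_inner D (u n) w) \<longlonglongrightarrow> L2_inner D v w"
proof -
  have "norm (L2_inner D (u n) w - L2_inner D v w) \<le> L2_norm D (\<lambda>x. u n x - v x) * L2_norm D w" for n
    using L2_Cauchy_Schwarz[OF L2_diff[OF assms(1)[of n] assms(2)] assms(3)]
    by (simp add: L2_inner_diff_left assms)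
  moreover have "(\<lambda>n. L2_norm D (\<lambda>x. u n x - v x) * L2_norm D w) \<longlonglongrightarrow> 0"
    using tendsto_mult_right[OF assms(4), of "L2_norm D w"] by simp
  ultimately have "(\<lambda>n. L2_inner D (u n) w - L2_inner D v w) \<longlonglongrightarrow> 0"
    by (intro Lim_null_comparison[where f="\<lambda>n. L2_inner D (u n) w - L2_inner D v w"]) simp_all
  then show ?thesis by (simp add: LIM_zero_iff)
qed

text \<open>Completeness of \<open>L\<^sup>2\<close>. The squared partial sums of \<open>\<Sum> \<bar>x\<^sub>k\<bar>\<close> increase and their integrals stay below
  \<open>(\<Sum> \<parallel>x\<^sub>k\<parallel>)\<^sup>2\<close>, so by monotone convergence their supremum is integrable. It is therefore finite almost
  everywhere, which gives pointwise absolute convergence, and it dominates the series of the \<open>x\<^sub>k\<close>.\<close>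
lemma L2_Riesz_Fischer:
  assumes x: "\<And>n. x n \<in> L2 D" and sm: "summable (\<lambda>n. L2_norm D (x n))"
  obtains u where "u \<in> L2 D" "(\<lambda>n. L2_norm D (\<lambda>y. (\<Sum>k<n. x k y) - u y)) \<longlonglongrightarrow> 0"
proof -
  define M where "M = lebesgue_on D"
  define S where "S = (\<Sum>n. L2_norm D (x n))"
  \<comment> \<open>squares of the partial sums of \<open>\<Sum> \<bar>x\<^sub>k\<bar>\<close>\<close>
  define h where "h n y = (\<Sum>k<n. norm (x k y))\<^sup>2" for n y
  have [measurable]: "x n \<in> borel_measurable M" for n
    unfolding M_def by (rule L2_measurable[OF x])
  have h_meas [measurable]: "h n \<in> borel_measurable M" for n
    unfolding h_def by measurable
  have h_int: "(\<integral>\<^sup>+y. ennreal (h n y) \<partial>M) \<le> ennreal (S\<^sup>2)" for n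
  proof -
    define g where "g k y = complex_of_real (norm (x k y))" for k y
    have g: "g k \<in> L2 D" for k
      by (rule L2_dominated[OF _ L2_integrable_norm_sq[OF x[of k]]])
         (use L2_measurable[OF x[of k]] in \<open>auto simp: g_def[abs_def]\<close>)
    have Ng: "L2_norm D (g k) = L2_norm D (x k)" for k
      by (simp add: L2_norm_def g_def)
    have sum: "(\<lambda>y. \<Sum>k<n. g k y) \<in> L2 D"
      by (intro L2_sum g)
    have h_eq: "h n y = (norm (\<Sum>k<n. g k y))\<^sup>2" for y
    proof -
      have "norm (\<Sum>k<n. g k y) = \<bar>\<Sum>k<n. norm (x k y)\<bar>"
        unfolding g_def of_real_sum[symmetric] norm_of_real ..
      then show ?thesis by (simp add: h_def)
    qed
    have "(\<integral>\<^sup>+y. ennreal (h n y) \<partial>M) = ennreal ((L2_norm D (\<lambda>y. \<Sum>k<n. g k y))\<^sup>2)"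
      unfolding h_eq M_def L2_norm_power2
      by (rule nn_integral_eq_integral[OF L2_integrable_norm_sq[OF sum]]) simp
    also have "\<dots> \<le> ennreal (S\<^sup>2)"
    proof (intro ennreal_leI power_mono L2_norm_nonneg)
      have "L2_norm D (\<lambda>y. \<Sum>k<n. g k y) \<le> (\<Sum>k<n. L2_norm D (x k))"
        using L2_norm_sum_le[of "{..<n}" g D] g by (simp add: Ng)
      also have "\<dots> \<le> S"
        unfolding S_def by (intro sum_le_suminf sm) (auto simp: L2_norm_nonneg)
      finally show "L2_norm D (\<lambda>y. \<Sum>k<n. g k y) \<le> S" .
    qed
    finally show ?thesis .
  qed
  define w where "w y = (SUP n. ennreal (h n y))" for y
  have w_meas [measurable]: "w \<in> borel_measurable M"
    unfolding w_def by measurable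
  have "(\<integral>\<^sup>+y. w y \<partial>M) = (SUP n. \<integral>\<^sup>+y. ennreal (h n y) \<partial>M)"
    unfolding w_def
  proof (rule nn_integral_monotone_convergence_SUP)
    show "incseq (\<lambda>n y. ennreal (h n y))"
      unfolding incseq_def le_fun_def h_def
      by (intro allI impI ennreal_leI power_mono sum_mono2) (auto intro: sum_nonneg)
  qed measurable
  also have "\<dots> \<le> ennreal (S\<^sup>2)"
    by (intro SUP_least h_int)
  finally have w_fin: "(\<integral>\<^sup>+y. w y \<partial>M) < \<infinity>"
    using ennreal_less_top le_less_trans by (metis infinity_ennreal_def)
  have AE_fin: "AE y in M. w y \<noteq> \<infinity>"
    using w_fin by (intro nn_integral_PInf_AE) auto
  have AE_bound: "AE y in M. \<forall>n. h n y \<le> enn2real (w y)"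
    using AE_fin
  proof eventually_elim
    case (elim y)
    have "ennreal (h n y) \<le> w y" for n
      unfolding w_def by (rule SUP_upper) simp
    then show ?case
      using elim by (metis enn2real_mono enn2real_ennreal h_def infinity_ennreal_def top.not_eq_extremum zero_le_power2)
  qed
  have w_int: "integrable M (\<lambda>y. enn2real (w y))"
  proof (rule integrableI_bounded)
    have "(\<integral>\<^sup>+y. ennreal (norm (enn2real (w y))) \<partial>M) \<le> (\<integral>\<^sup>+y. w y \<partial>M)"
      by (intro nn_integral_mono) (simp add: ennreal_enn2real_if)
    then show "(\<integral>\<^sup>+y. ennreal (norm (enn2real (w y))) \<partial>M) < \<infinity>"
      using w_fin by (rule le_less_trans)
  qed measurable
  have lim: "AE y in M. (\<lambda>n. \<Sum>k<n. x k y) \<longlonglongrightarrow> (\<Sum>k. x k y)"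
    using AE_bound
  proof eventually_elim
    case (elim y)
    have "(\<Sum>k<n. norm (x k y)) \<le> sqrt (enn2real (w y))" for n
      using elim by (intro real_le_rsqrt) (auto simp: h_def)
    then have "summable (\<lambda>k. norm (x k y))"
      by (intro summableI_nonneg_bounded) auto
    then show ?case
      by (intro summable_LIMSEQ summable_norm_cancel[of "\<lambda>k. x k y"])
  qed
  have bound: "AE y in M. (norm (\<Sum>k<n. x k y))\<^sup>2 \<le> enn2real (w y)" for n
    using AE_bound
  proof eventually_elim
    case (elim y)
    have "(norm (\<Sum>k<n. x k y))\<^sup>2 \<le> h n y"
      unfolding h_def by (intro power_mono norm_sum) auto
    then show ?case using elim order_trans by blast
  qed
  note conv = L2_dominated_convergence[of "\<lambda>n y. \<Sum>k<n. x k y" D "\<lambda>y. \<Sum>k. x k y",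
      folded M_def, OF _ _ w_int lim bound]
  show thesis
    by (rule that[OF conv(2,3)]) measurable
qed

section \<open>Bounded operators and uniform boundedness\<close>

text \<open>Bounded linear operators on \<open>L\<^sup>2(D)\<close>, acting on representatives. Linearity holds only almost
  everywhere because elements of \<open>L\<^sup>2(D)\<close> are represented by functions.\<close>
definition L2_operator :: "'a::euclidean_space set \<Rightarrow> (('a \<Rightarrow> complex) \<Rightarrow> 'a \<Rightarrow> complex) \<Rightarrow> bool" where
  "L2_operator D A \<longleftrightarrow> (\<forall>u\<in>L2 D. A u \<in> L2 D) \<and>
     (\<forall>u\<in>L2 D. \<forall>v\<in>L2 D. \<forall>c. AE x in lebesgue_on D. A (\<lambda>y. c * u y + v y) x = c * A u x + A v x) \<and>
     (\<exists>C. \<forall>u\<in>L2 D. L2_norm D (A u) \<le> C * L2_norm D u)"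

lemma C0_semigroup_operator: "C0_semigroup D T \<Longrightarrow> 0 \<le> t \<Longrightarrow> L2_operator D (T t)"
  by (simp add: C0_semigroup_def L2_operator_def)

context
  fixes D :: "'a::euclidean_space set" and A :: "('a \<Rightarrow> complex) \<Rightarrow> 'a \<Rightarrow> complex"
  assumes A: "L2_operator D A"
begin

lemma L2_operator_closed: "u \<in> L2 D \<Longrightarrow> A u \<in> L2 D"
  using A by (simp add: L2_operator_def)

lemma L2_operator_lincomb:
  "u \<in> L2 D \<Longrightarrow> v \<in> L2 D \<Longrightarrow> AE x in lebesgue_on D. A (\<lambda>y. c * u y + v y) x = c * A u x + A v x"
  using A by (simp add: L2_operator_def)

lemma L2_operator_bound:
  obtains C where "0 < C" "\<And>u. u \<in> L2 D \<Longrightarrow> L2_norm D (A u) \<le> C * L2_norm D u"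
proof -
  obtain C where C: "\<And>u. u \<in> L2 D \<Longrightarrow> L2_norm D (A u) \<le> C * L2_norm D u"
    using A unfolding L2_operator_def by blast
  have "L2_norm D (A u) \<le> max C 1 * L2_norm D u" if "u \<in> L2 D" for u
    by (rule order_trans[OF C[OF that]]) (simp add: mult_right_mono L2_norm_nonneg)
  then show thesis by (intro that[of "max C 1"]) auto
qed

lemma L2_operator_add:
  "u \<in> L2 D \<Longrightarrow> v \<in> L2 D \<Longrightarrow> AE x in lebesgue_on D. A (\<lambda>y. u y + v y) x = A u x + A v x"
  using L2_operator_lincomb[of u v 1] by simp

lemma L2_operator_diff:
  "u \<in> L2 D \<Longrightarrow> v \<in> L2 D \<Longrightarrow> AE x in lebesgue_on D. A (\<lambda>y. u y - v y) x = A u x - A v x"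
  using L2_operator_lincomb[of v u "-1"] by simp

lemma L2_operator_cmult:
  assumes "u \<in> L2 D"
  shows "AE x in lebesgue_on D. A (\<lambda>y. c * u y) x = c * A u x"
proof -
  have "AE x in lebesgue_on D. A (\<lambda>y. 0) x = 0"
    using L2_operator_lincomb[OF L2_zero L2_zero, of 1] by simp
  then show ?thesis
    using L2_operator_lincomb[OF assms L2_zero, of c] by eventually_elim simp
qed

text \<open>Boundedness sends the null function \<open>u - v\<close> to a null function, so the operator is well defined
  on classes modulo equality almost everywhere.\<close>
lemma L2_operator_cong:
  assumes "u \<in> L2 D" "v \<in> L2 D" "AE x in lebesgue_on D. u x = v x"
  shows "AE x in lebesgue_on D. A u x = A v x"
proof -
  obtain C where C: "0 < C" "\<And>u. u \<in> L2 D \<Longrightarrow> L2_norm D (A u) \<le> C * L2_norm D u"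
    by (rule L2_operator_bound) blast
  have d: "(\<lambda>x. u x - v x) \<in> L2 D"
    by (rule L2_diff[OF assms(1,2)])
  have "L2_norm D (\<lambda>x. u x - v x) = L2_norm D (\<lambda>x. 0)"
    by (rule L2_norm_cong[OF _ d L2_zero]) (use assms(3) in \<open>auto elim: eventually_mono\<close>)
  also have "\<dots> = 0"
    by (simp add: L2_norm_def)
  finally have "L2_norm D (A (\<lambda>x. u x - v x)) = 0"
    using C(2)[OF d] L2_norm_nonneg[of D "A (\<lambda>x. u x - v x)"] by simp
  then have "AE x in lebesgue_on D. A (\<lambda>x. u x - v x) x = 0"
    by (rule L2_norm_eq_0_AE[OF L2_operator_closed[OF d]])
  then show ?thesis
    using L2_operator_diff[OF assms(1,2)] by eventually_elim simp
qed

lemma L2_operator_norm_diff: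
  assumes "u \<in> L2 D" "v \<in> L2 D"
  shows "L2_norm D (\<lambda>x. A u x - A v x) = L2_norm D (A (\<lambda>y. u y - v y))"
  by (rule L2_norm_cong)
     (use L2_operator_diff[OF assms] in \<open>auto elim: eventually_mono intro!: L2_diff L2_operator_closed assms\<close>)

lemma L2_operator_tendsto:
  assumes "\<And>n. u n \<in> L2 D" "v \<in> L2 D" "(\<lambda>n. L2_norm D (\<lambda>x. u n x - v x)) \<longlonglongrightarrow> 0"
  shows "(\<lambda>n. L2_norm D (\<lambda>x. A (u n) x - A v x)) \<longlonglongrightarrow> 0"
proof -
  obtain C where C: "0 < C" "\<And>u. u \<in> L2 D \<Longrightarrow> L2_norm D (A u) \<le> C * L2_norm D u"
    by (rule L2_operator_bound) blast
  have "L2_norm D (\<lambda>x. A (u n) x - A v x) \<le> C * L2_norm D (\<lambda>x. u n x - v x)" for n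
    using C(2)[OF L2_diff[OF assms(1)[of n] assms(2)]]
    by (simp add: L2_operator_norm_diff assms(1,2))
  moreover have "(\<lambda>n. C * L2_norm D (\<lambda>x. u n x - v x)) \<longlonglongrightarrow> 0"
    using tendsto_mult_left[OF assms(3), of C] by simp
  ultimately show ?thesis
    by (intro Lim_null_comparison[where f="\<lambda>n. L2_norm D (\<lambda>x. A (u n) x - A v x)"])
       (simp_all add: L2_norm_nonneg)
qed

end

text \<open>One step of the gliding hump. If \<open>w\<close> witnesses a large operator norm, rescale it to \<open>v\<close> with
  \<open>\<parallel>v\<parallel> = r/2\<close> and \<open>\<parallel>A v\<parallel> > K + 1\<close>. Since \<open>2 A v = A (x + v) - A (x - v)\<close>, the operator is large at one of
  the points \<open>x \<plusminus> v\<close>, and by continuity it remains at least \<open>K\<close> on a small ball around that point.\<close>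
lemma L2_operator_large_on_ball:
  assumes A: "L2_operator D A" and x: "x \<in> L2 D" and r: "0 < r" and K: "0 \<le> K"
    and w: "w \<in> L2 D" and big: "2 * (K + 1) / r * L2_norm D w < L2_norm D (A w)"
  shows "\<exists>y r'. y \<in> L2 D \<and> 0 < r' \<and> r' \<le> r / 2 \<and> L2_norm D (\<lambda>z. y z - x z) \<le> r / 2 \<and>
           (\<forall>u\<in>L2 D. L2_norm D (\<lambda>z. u z - y z) \<le> r' \<longrightarrow> K \<le> L2_norm D (A u))"
proof -
  note op = L2_operator_closed[OF A]
  obtain C where C: "0 < C" "\<And>u. u \<in> L2 D \<Longrightarrow> L2_norm D (A u) \<le> C * L2_norm D u"
    by (rule L2_operator_bound[OF A]) blast
  have Nw: "0 < L2_norm D w"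
  proof (rule ccontr)
    assume "\<not> ?thesis"
    then have "L2_norm D w = 0" using L2_norm_nonneg[of D w] by simp
    with big C(2)[OF w] show False by simp
  qed
  define c where "c = complex_of_real (r / (2 * L2_norm D w))"
  define v where "v = (\<lambda>y. c * w y)"
  have v: "v \<in> L2 D" unfolding v_def by (rule L2_cmult[OF w])
  have nc: "norm c = r / (2 * L2_norm D w)"
    using r Nw unfolding c_def norm_of_real by simp
  have Nv: "L2_norm D v = r / 2"
    unfolding v_def L2_norm_cmult nc using Nw by simp
  have "L2_norm D (A v) = L2_norm D (\<lambda>y. c * A w y)"
    unfolding v_def by (rule L2_norm_cong[OF L2_operator_cmult[OF A w]]) (intro op L2_cmult w)+
  also have "\<dots> = r / (2 * L2_norm D w) * L2_norm D (A w)"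
    unfolding L2_norm_cmult nc ..
  finally have NAv_eq: "L2_norm D (A v) = r / (2 * L2_norm D w) * L2_norm D (A w)" .
  have "K + 1 = r / (2 * L2_norm D w) * (2 * (K + 1) / r * L2_norm D w)"
    using r Nw by simp
  also have "\<dots> < L2_norm D (A v)"
    unfolding NAv_eq by (rule mult_strict_left_mono[OF big]) (use r Nw in simp)
  finally have NAv: "K + 1 < L2_norm D (A v)" .
  have p: "(\<lambda>y. x y + v y) \<in> L2 D" and m: "(\<lambda>y. x y - v y) \<in> L2 D"
    by (intro L2_add L2_diff x v)+
  have Ap: "AE y in lebesgue_on D. A (\<lambda>y. x y + v y) y = A x y + A v y"
    by (rule L2_operator_add[OF A x v])
  have Am: "AE y in lebesgue_on D. A (\<lambda>y. x y - v y) y = A x y - A v y"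
    by (rule L2_operator_diff[OF A x v])
  have "2 * L2_norm D (A v) = L2_norm D (\<lambda>y. 2 * A v y)"
    by (simp add: L2_norm_cmult)
  also have "\<dots> = L2_norm D (\<lambda>y. A (\<lambda>y. x y + v y) y + (-1) * A (\<lambda>y. x y - v y) y)"
    by (rule L2_norm_cong)
       (use Ap Am in \<open>auto elim: eventually_elim2 intro!: L2_add L2_diff L2_cmult op p m v\<close>)
  also have "\<dots> \<le> L2_norm D (A (\<lambda>y. x y + v y)) + L2_norm D (\<lambda>y. (-1) * A (\<lambda>y. x y - v y) y)"
    by (intro L2_norm_triangle L2_cmult op p m)
  also have "L2_norm D (\<lambda>y. (-1) * A (\<lambda>y. x y - v y) y) = L2_norm D (A (\<lambda>y. x y - v y))"
    by (subst L2_norm_cmult) simp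
  finally have "K + 1 \<le> L2_norm D (A (\<lambda>y. x y + v y)) \<or> K + 1 \<le> L2_norm D (A (\<lambda>y. x y - v y))"
    using NAv by linarith
  then obtain y where y: "y \<in> L2 D" "L2_norm D (\<lambda>z. y z - x z) \<le> r / 2" "K + 1 \<le> L2_norm D (A y)"
  proof
    assume "K + 1 \<le> L2_norm D (A (\<lambda>y. x y + v y))"
    then show thesis using p Nv by (intro that) auto
  next
    assume "K + 1 \<le> L2_norm D (A (\<lambda>y. x y - v y))"
    then show thesis using m Nv L2_norm_cmult[of D "-1" v] by (intro that) auto
  qed
  define r' where "r' = min (r / 2) (1 / C)"
  have r': "0 < r'" "r' \<le> r / 2" "C * r' \<le> 1"
    using r C(1) by (auto simp: r'_def min_def field_simps)
  have "K \<le> L2_norm D (A u)" if u: "u \<in> L2 D" "L2_norm D (\<lambda>z. u z - y z) \<le> r'" for u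
  proof -
    have "L2_norm D (A y) \<le> L2_norm D (\<lambda>z. A y z - A u z) + L2_norm D (A u)"
      using L2_norm_triangle[OF L2_diff[OF op[OF y(1)] op[OF u(1)]] op[OF u(1)]] by simp
    also have "L2_norm D (\<lambda>z. A y z - A u z) \<le> C * L2_norm D (\<lambda>z. y z - u z)"
      unfolding L2_operator_norm_diff[OF A y(1) u(1)] by (rule C(2)[OF L2_diff[OF y(1) u(1)]])
    also have "\<dots> \<le> C * r'"
      using u(2) C(1) by (simp add: L2_norm_minus_commute[of D y u])
    finally show ?thesis using r'(3) y(3) by linarith
  qed
  then show ?thesis using y r' by blast
qed

text \<open>The principle of uniform boundedness. Were the operators not uniformly bounded, the previous
  lemma would produce nested balls with radii at most \<open>2\<^sup>-\<^sup>k\<close> such that on the ball number \<open>k + 1\<close> some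
  \<open>\<parallel>S\<^sub>n u\<parallel>\<close> is at least \<open>k\<close>. By completeness the centres converge to a point of all the balls, and
  at that point the family is unbounded.\<close>
lemma L2_uniform_boundedness:
  fixes S :: "nat \<Rightarrow> ('a::euclidean_space \<Rightarrow> complex) \<Rightarrow> 'a \<Rightarrow> complex"
  assumes S: "\<And>n. L2_operator D (S n)"
    and pointwise: "\<And>u. u \<in> L2 D \<Longrightarrow> \<exists>B. \<forall>n. L2_norm D (S n u) \<le> B"
  shows "\<exists>C. \<forall>n. \<forall>u\<in>L2 D. L2_norm D (S n u) \<le> C * L2_norm D u"
proof (rule ccontr)
  assume "\<not> ?thesis"
  then have unbounded: "\<exists>n. \<exists>w\<in>L2 D. C * L2_norm D w < L2_norm D (S n w)" for C
    by (auto simp: not_le)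
  define Q where "Q k s s' \<longleftrightarrow> snd s' \<le> snd s / 2 \<and> L2_norm D (\<lambda>z. fst s' z - fst s z) \<le> snd s / 2 \<and>
      (\<exists>n. \<forall>u\<in>L2 D. L2_norm D (\<lambda>z. u z - fst s' z) \<le> snd s' \<longrightarrow> real k \<le> L2_norm D (S n u))"
    for k :: nat and s s' :: "('a \<Rightarrow> complex) \<times> real"
  have "\<exists>s. \<forall>k. (fst (s k) \<in> L2 D \<and> 0 < snd (s k) \<and> (k = 0 \<longrightarrow> snd (s k) = 1)) \<and> Q k (s k) (s (Suc k))"
  proof (rule dependent_nat_choice)
    show "\<exists>s. fst s \<in> L2 D \<and> 0 < snd s \<and> ((0::nat) = 0 \<longrightarrow> snd s = (1::real))"
      using L2_zero by (intro exI[of _ "(\<lambda>_. 0, 1)"]) auto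
  next
    fix s :: "('a \<Rightarrow> complex) \<times> real" and k :: nat
    assume s: "fst s \<in> L2 D \<and> 0 < snd s \<and> (k = 0 \<longrightarrow> snd s = 1)"
    obtain n w where nw: "w \<in> L2 D" "2 * (real k + 1) / snd s * L2_norm D w < L2_norm D (S n w)"
      using unbounded by blast
    obtain y r' where "y \<in> L2 D" "0 < r'" "r' \<le> snd s / 2" "L2_norm D (\<lambda>z. y z - fst s z) \<le> snd s / 2"
      "\<forall>u\<in>L2 D. L2_norm D (\<lambda>z. u z - y z) \<le> r' \<longrightarrow> real k \<le> L2_norm D (S n u)"
      using L2_operator_large_on_ball[OF S, of "fst s" "snd s" "real k", OF _ _ _ nw] s by force
    then show "\<exists>s'. (fst s' \<in> L2 D \<and> 0 < snd s' \<and> (Suc k = 0 \<longrightarrow> snd s' = 1)) \<and> Q k s s'"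
      unfolding Q_def by (intro exI[of _ "(y, r')"]) auto
  qed
  then obtain s where s: "\<And>k. fst (s k) \<in> L2 D" "\<And>k. 0 < snd (s k)" "snd (s 0) = 1"
    and Q: "\<And>k. Q k (s k) (s (Suc k))"
    by blast
  define x r where "x k = fst (s k)" and "r k = snd (s k)" for k
  have x: "x k \<in> L2 D" and r_pos: "0 < r k" for k
    using s by (auto simp: x_def r_def)
  have r_half: "r (Suc k) \<le> r k / 2" and step: "L2_norm D (\<lambda>z. x (Suc k) z - x k z) \<le> r k / 2"
    and large: "\<exists>n. \<forall>u\<in>L2 D. L2_norm D (\<lambda>z. u z - x (Suc k) z) \<le> r (Suc k) \<longrightarrow> real k \<le> L2_norm D (S n u)" for k
    using Q[of k] by (auto simp: Q_def x_def r_def)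
  have r_geom: "r k \<le> (1/2) ^ k" for k
  proof (induction k)
    case 0 then show ?case by (simp add: r_def s)
  next
    case (Suc k) then show ?case using r_half[of k] by simp
  qed
  have "summable (\<lambda>k. L2_norm D (\<lambda>z. x (Suc k) z - x k z))"
  proof (rule summable_comparison_test')
    show "summable (\<lambda>k. (1/2::real) ^ k)"
      by (rule summable_geometric) simp
    show "norm (L2_norm D (\<lambda>z. x (Suc k) z - x k z)) \<le> (1/2) ^ k" if "k \<ge> 0" for k
      using step[of k] r_geom[of k] r_pos[of k] by (simp add: L2_norm_nonneg)
  qed
  then obtain v where v: "v \<in> L2 D"
    and v_lim: "(\<lambda>n. L2_norm D (\<lambda>z. (\<Sum>k<n. x (Suc k) z - x k z) - v z)) \<longlonglongrightarrow> 0"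
    by (rule L2_Riesz_Fischer[rotated]) (auto intro: L2_diff x)
  define u where "u = (\<lambda>z. x 0 z + v z)"
  have u: "u \<in> L2 D" unfolding u_def by (rule L2_add[OF x v])
  have tel: "(\<Sum>k<n. x (Suc k) z - x k z) = x n z - x 0 z" for n z
    by (rule sum_lessThan_telescope)
  have u_lim: "(\<lambda>n. L2_norm D (\<lambda>z. x n z - u z)) \<longlonglongrightarrow> 0"
    using v_lim unfolding tel u_def by (simp add: algebra_simps)
  \<comment> \<open>as \<open>r\<^sub>k/2 \<le> r\<^sub>k - r\<^sub>k\<^sub>+\<^sub>1\<close>, the distances of the centres telescope\<close>
  have dist: "L2_norm D (\<lambda>z. x (n + m) z - x n z) \<le> r n - r (n + m)" for n m
  proof (induction m)
    case 0 then show ?case by (simp add: L2_norm_def)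
  next
    case (Suc m)
    show ?case
      using L2_norm_triangle_diff[OF x[of "Suc (n + m)"] x[of "n + m"] x[of n]] Suc
        step[of "n + m"] r_half[of "n + m"] by simp
  qed
  have "L2_norm D (\<lambda>z. u z - x n z) \<le> r n" for n
  proof (rule LIMSEQ_le_const)
    show "(\<lambda>m. L2_norm D (\<lambda>z. x (m + n) z - u z) + r n) \<longlonglongrightarrow> r n"
      using tendsto_add[OF LIMSEQ_ignore_initial_segment[OF u_lim, of n] tendsto_const[of "r n"]] by simp
    have "L2_norm D (\<lambda>z. u z - x n z) \<le> L2_norm D (\<lambda>z. x (m + n) z - u z) + r n" for m
      using L2_norm_triangle_diff[OF u x[of "m + n"] x[of n]] dist[of n m] r_pos[of "n + m"]
        L2_norm_minus_commute[of D u "x (m + n)"] by (simp add: add.commute)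
    then show "\<exists>N. \<forall>m\<ge>N. L2_norm D (\<lambda>z. u z - x n z) \<le> L2_norm D (\<lambda>z. x (m + n) z - u z) + r n"
      by blast
  qed
  then have "\<exists>n. real k \<le> L2_norm D (S n u)" for k
    using large[of k] u by blast
  moreover obtain B where "\<And>n. L2_norm D (S n u) \<le> B"
    using pointwise[OF u] by blast
  moreover obtain k where "B < real k"
    using reals_Archimedean2 by blast
  ultimately show False
    by (meson not_less order_trans)
qed

section \<open>Eigenvectors of strongly continuous semigroups\<close>

text \<open>Strong continuity is a one-sided limit over positive times; here it is used along sequences
  which may also take the value \<open>0\<close>.\<close>
lemma C0_semigroup_continuous_0:
  assumes "C0_semigroup D T" "u \<in> L2 D" "\<And>n. 0 \<le> t n" "t \<longlonglongrightarrow> 0"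
  shows "(\<lambda>n. L2_norm D (\<lambda>x. T (t n) u x - u x)) \<longlonglongrightarrow> 0"
proof -
  define g where "g s = L2_norm D (\<lambda>x. T s u x - u x)" for s
  have "(g \<longlongrightarrow> 0) (at_right 0)"
    using assms(1,2) unfolding C0_semigroup_def g_def by blast
  moreover have "g 0 = 0"
  proof -
    have T0: "T 0 u \<in> L2 D" "AE x in lebesgue_on D. T 0 u x = u x"
      using assms(1,2) by (auto simp: C0_semigroup_def)
    have "g 0 = L2_norm D (\<lambda>x. 0)"
      unfolding g_def
      by (rule L2_norm_cong) (use T0 assms(2) in \<open>auto intro!: L2_diff L2_zero elim: eventually_mono\<close>)
    then show ?thesis by (simp add: L2_norm_def)
  qed
  ultimately have "(g \<longlongrightarrow> 0) (at 0 within {0..})"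
    by (simp add: at_within_Ici_at_right)
  with \<open>g 0 = 0\<close> have "continuous (at 0 within {0..}) g"
    by (simp add: continuous_within)
  then have "(\<lambda>n. g (t n)) \<longlonglongrightarrow> g 0"
    using assms(3,4) by (auto simp: continuous_within_sequentially comp_def)
  then show ?thesis
    using \<open>g 0 = 0\<close> by (simp add: g_def)
qed

text \<open>Each operator has its own bound, and strong continuity at \<open>0\<close> controls only individual orbits.
  If no uniform bound held near \<open>0\<close>, there would be times \<open>t\<^sub>n\<close> tending to \<open>0\<close> with unbounded operator
  norms, although every sequence \<open>T(t\<^sub>n) u\<close> converges; uniform boundedness excludes this.\<close>
lemma C0_semigroup_locally_bounded:
  assumes T: "C0_semigroup D T"
  obtains \<delta> C where "0 < \<delta>" "0 < C"
    "\<And>t u. 0 \<le> t \<Longrightarrow> t \<le> \<delta> \<Longrightarrow> u \<in> L2 D \<Longrightarrow> L2_norm D (T t u) \<le> C * L2_norm D u"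
proof -
  have "\<exists>n::nat. \<forall>t. 0 \<le> t \<and> t \<le> inverse (real (Suc n)) \<longrightarrow>
          (\<forall>u\<in>L2 D. L2_norm D (T t u) \<le> real n * L2_norm D u)"
  proof (rule ccontr)
    assume "\<not> ?thesis"
    then have "\<forall>n. \<exists>t u. 0 \<le> t \<and> t \<le> inverse (real (Suc n)) \<and> u \<in> L2 D \<and>
        real n * L2_norm D u < L2_norm D (T t u)"
      by (meson not_le)
    then obtain t u where t: "\<And>n. 0 \<le> t n" "\<And>n. t n \<le> inverse (real (Suc n))"
      and u: "\<And>n. u n \<in> L2 D" "\<And>n. real n * L2_norm D (u n) < L2_norm D (T (t n) (u n))"
      by metis
    have t_lim: "t \<longlonglongrightarrow> 0"
      by (rule tendsto_sandwich[OF _ _ tendsto_const LIMSEQ_inverse_real_of_nat]) (use t in auto)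
    have op: "L2_operator D (T (t n))" for n
      by (rule C0_semigroup_operator[OF T t(1)])
    have "\<exists>C. \<forall>n. \<forall>u\<in>L2 D. L2_norm D (T (t n) u) \<le> C * L2_norm D u"
    proof (rule L2_uniform_boundedness[OF op])
      fix v assume v: "v \<in> L2 D"
      have "(\<lambda>n. L2_norm D (T (t n) v)) \<longlonglongrightarrow> L2_norm D v"
        by (rule L2_norm_tendsto[OF L2_operator_closed[OF op v] v C0_semigroup_continuous_0[OF T v t(1) t_lim]])
      then have "Bseq (\<lambda>n. L2_norm D (T (t n) v))"
        by (intro convergent_imp_Bseq) (auto simp: convergent_def)
      then show "\<exists>B. \<forall>n. L2_norm D (T (t n) v) \<le> B"
        by (auto simp: Bseq_def L2_norm_nonneg)
    qed
    then obtain C where C: "\<And>n u. u \<in> L2 D \<Longrightarrow> L2_norm D (T (t n) u) \<le> C * L2_norm D u"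
      by blast
    obtain n where "C \<le> real n"
      using real_arch_simple by blast
    then have "L2_norm D (T (t n) (u n)) \<le> real n * L2_norm D (u n)"
      using C[OF u(1), of n n] by (meson L2_norm_nonneg mult_right_mono order_trans)
    with u(2)[of n] show False by simp
  qed
  then obtain n where n: "\<And>t u. 0 \<le> t \<Longrightarrow> t \<le> inverse (real (Suc n)) \<Longrightarrow> u \<in> L2 D \<Longrightarrow>
      L2_norm D (T t u) \<le> real n * L2_norm D u"
    by blast
  show thesis
  proof (rule that[of "inverse (real (Suc n))" "real (Suc n)"])
    fix t u assume "0 \<le> t" "t \<le> inverse (real (Suc n))" "u \<in> L2 D"
    then have "L2_norm D (T t u) \<le> real n * L2_norm D u" by (rule n)
    also have "\<dots> \<le> real (Suc n) * L2_norm D u"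
      by (intro mult_right_mono) (auto simp: L2_norm_nonneg)
    finally show "L2_norm D (T t u) \<le> real (Suc n) * L2_norm D u" .
  qed auto
qed

text \<open>On an eigenvector with eigenvalue \<open>- \<mu>\<close> both \<open>T(h) e\<close> and \<open>e\<^sup>-\<^sup>\<mu>\<^sup>h e\<close> have the right derivative
  \<open>- \<mu> e\<close> at \<open>0\<close>, so they differ by \<open>o(h)\<close>.\<close>
lemma generator_eigenvector_defect:
  assumes T: "C0_semigroup D T" and e: "e \<in> L2 D"
    and gen: "generator D T e (\<lambda>x. - complex_of_real \<mu> * e x)"
  shows "((\<lambda>h. L2_norm D (\<lambda>x. T h e x - of_real (exp (- \<mu> * h)) * e x) / h) \<longlongrightarrow> 0) (at_right 0)"
proof (rule Lim_null_comparison)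
  \<comment> \<open>the errors of the two difference quotients at \<open>h\<close>\<close>
  define q where "q h = (exp (- \<mu> * h) - 1) / h + \<mu>" for h
  define p where "p h = L2_norm D (\<lambda>x. (T h e x - e x) / of_real h - - complex_of_real \<mu> * e x)" for h
  have "(p \<longlongrightarrow> 0) (at_right 0)"
    using gen by (simp add: generator_def p_def[abs_def])
  moreover have "(q \<longlongrightarrow> 0) (at_right 0)"
  proof -
    have "((\<lambda>h. exp (- \<mu> * h)) has_field_derivative - \<mu>) (at 0)"
      by (auto intro!: derivative_eq_intros)
    then have "((\<lambda>h. (exp (- \<mu> * h) - 1) / h) \<longlongrightarrow> - \<mu>) (at 0)"
      by (simp add: DERIV_def)
    then have "((\<lambda>h. (exp (- \<mu> * h) - 1) / h) \<longlongrightarrow> - \<mu>) (at_right 0)"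
      by (rule tendsto_mono[rotated]) (simp add: at_le)
    from tendsto_add[OF this tendsto_const[of \<mu>]] show ?thesis
      by (simp add: q_def[abs_def])
  qed
  ultimately show "((\<lambda>h. p h + \<bar>q h\<bar> * L2_norm D e) \<longlongrightarrow> 0) (at_right 0)"
    by (auto intro!: tendsto_eq_intros)
  show "\<forall>\<^sub>F h in at_right 0. norm (L2_norm D (\<lambda>x. T h e x - of_real (exp (- \<mu> * h)) * e x) / h)
           \<le> p h + \<bar>q h\<bar> * L2_norm D e"
    using eventually_at_right_less[of "0::real"]
  proof eventually_elim
    case (elim h)
    have Th: "T h e \<in> L2 D"
      using L2_operator_closed[OF C0_semigroup_operator[OF T]] e elim by simp
    have "L2_norm D (\<lambda>x. T h e x - of_real (exp (- \<mu> * h)) * e x) / h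
        = L2_norm D (\<lambda>x. of_real (1 / h) * (T h e x - of_real (exp (- \<mu> * h)) * e x))"
      using elim by (subst L2_norm_cmult) (simp add: norm_divide)
    also have "\<dots> = L2_norm D (\<lambda>x. ((T h e x - e x) / of_real h - - complex_of_real \<mu> * e x)
                  + of_real (- q h) * e x)"
      using elim by (intro arg_cong[where f="L2_norm D"] ext) (simp add: q_def field_simps)
    also have "\<dots> \<le> p h + L2_norm D (\<lambda>x. of_real (- q h) * e x)"
      unfolding p_def
    proof (rule L2_norm_triangle)
      have "(\<lambda>x. of_real (1 / h) * (T h e x - e x) - - complex_of_real \<mu> * e x) \<in> L2 D"
        by (intro L2_diff L2_cmult Th e)
      then show "(\<lambda>x. (T h e x - e x) / of_real h - - complex_of_real \<mu> * e x) \<in> L2 D"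
        by (simp add: divide_inverse mult.commute of_real_inverse)
    qed (intro L2_cmult e)
    also have "L2_norm D (\<lambda>x. of_real (- q h) * e x) = \<bar>q h\<bar> * L2_norm D e"
      by (subst L2_norm_cmult) (simp add: norm_of_real del: of_real_minus)
    finally show ?case
      using elim by (simp add: L2_norm_nonneg)
  qed
qed

text \<open>Divide \<open>[0, t]\<close> into \<open>n\<close> steps of length \<open>h\<close>. Every step adds an error of at most \<open>C\<close> times the
  defect at \<open>h\<close>, because the operators are bounded by \<open>C\<close> on the whole interval and
  \<open>e\<^sup>-\<^sup>\<mu>\<^sup>h \<le> 1\<close>. The total error \<open>n C o(h) = C t o(h)/h\<close> vanishes as \<open>n\<close> grows.\<close>
lemma C0_semigroup_eigenvector_small:
  assumes T: "C0_semigroup D T" and e: "e \<in> L2 D" and \<mu>: "0 \<le> \<mu>"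
    and gen: "generator D T e (\<lambda>x. - complex_of_real \<mu> * e x)"
    and bound: "0 < C" "\<And>t u. 0 \<le> t \<Longrightarrow> t \<le> \<delta> \<Longrightarrow> u \<in> L2 D \<Longrightarrow> L2_norm D (T t u) \<le> C * L2_norm D u"
    and t: "0 < t" "t \<le> \<delta>"
  shows "AE x in lebesgue_on D. T t e x = of_real (exp (- \<mu> * t)) * e x"
proof -
  define d where "d h = L2_norm D (\<lambda>x. T h e x - of_real (exp (- \<mu> * h)) * e x)" for h
  note Tcl = L2_operator_closed[OF C0_semigroup_operator[OF T]]
  have add: "AE x in lebesgue_on D. T (s + h) e x = T s (T h e) x" if "0 \<le> s" "0 \<le> h" for s h
    using T that e by (simp add: C0_semigroup_def)
  have step: "d (s + h) \<le> C * d h + d s" if sh: "0 \<le> s" "s \<le> \<delta>" "0 \<le> h" for s h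
  proof -
    note op = C0_semigroup_operator[OF T sh(1)]
    have Th: "T h e \<in> L2 D" and Ts: "T s e \<in> L2 D" and Tsh: "T (s + h) e \<in> L2 D" and TsTh: "T s (T h e) \<in> L2 D"
      using sh by (auto intro!: Tcl e)
    have w: "(\<lambda>x. T h e x - of_real (exp (- \<mu> * h)) * e x) \<in> L2 D"
      by (intro L2_diff L2_cmult Th e)
    have exp_eq: "complex_of_real (exp (- \<mu> * (s + h))) = of_real (exp (- \<mu> * h)) * of_real (exp (- \<mu> * s))"
      unfolding of_real_mult[symmetric] exp_add[symmetric] by (simp add: algebra_simps)
    have ae: "AE x in lebesgue_on D. T (s + h) e x - of_real (exp (- \<mu> * (s + h))) * e x
        = T s (\<lambda>x. T h e x - of_real (exp (- \<mu> * h)) * e x) x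
          + of_real (exp (- \<mu> * h)) * (T s e x - of_real (exp (- \<mu> * s)) * e x)"
      unfolding exp_eq using add[OF sh(1,3)] L2_operator_diff[OF op Th L2_cmult[OF e, of "of_real (exp (- \<mu> * h))"]]
        L2_operator_cmult[OF op e, of "of_real (exp (- \<mu> * h))"]
      by eventually_elim (simp add: algebra_simps exp_add)
    have "d (s + h) = L2_norm D (\<lambda>x. T s (\<lambda>x. T h e x - of_real (exp (- \<mu> * h)) * e x) x
          + of_real (exp (- \<mu> * h)) * (T s e x - of_real (exp (- \<mu> * s)) * e x))"
      unfolding d_def using sh
      by (intro L2_norm_cong[OF ae] L2_diff L2_add L2_cmult Tcl e) auto
    also have "\<dots> \<le> L2_norm D (T s (\<lambda>x. T h e x - of_real (exp (- \<mu> * h)) * e x))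
          + L2_norm D (\<lambda>x. of_real (exp (- \<mu> * h)) * (T s e x - of_real (exp (- \<mu> * s)) * e x))"
      using sh by (intro L2_norm_triangle L2_diff L2_cmult Tcl e) auto
    also have "L2_norm D (\<lambda>x. of_real (exp (- \<mu> * h)) * (T s e x - of_real (exp (- \<mu> * s)) * e x))
        = exp (- \<mu> * h) * d s"
      unfolding d_def by (subst L2_norm_cmult) simp
    also have "\<dots> \<le> 1 * d s"
      using \<mu> sh by (intro mult_right_mono) (auto simp: d_def L2_norm_nonneg)
    also have "L2_norm D (T s (\<lambda>x. T h e x - of_real (exp (- \<mu> * h)) * e x)) \<le> C * d h"
      unfolding d_def by (rule bound(2)[OF sh(1,2) w])
    finally show ?thesis by simp
  qed
  have d0: "d 0 = 0"
  proof -
    have T0: "AE x in lebesgue_on D. T 0 e x = e x"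
      using T e by (simp add: C0_semigroup_def)
    have "d 0 = L2_norm D (\<lambda>x. 0)"
      unfolding d_def
      by (rule L2_norm_cong) (use T0 in \<open>auto intro!: L2_diff L2_zero Tcl e elim: eventually_mono\<close>)
    then show ?thesis by (simp add: L2_norm_def)
  qed
  have iter: "real j * h \<le> \<delta> \<Longrightarrow> d (real j * h) \<le> real j * (C * d h)" if "0 \<le> h" for j h
  proof (induction j)
    case 0 then show ?case by (simp add: d0)
  next
    case (Suc j)
    have "real j * h \<le> real (Suc j) * h"
      using that by (intro mult_right_mono) auto
    then have "real j * h \<le> \<delta>" using Suc.prems by linarith
    then show ?case
      using step[of "real j * h" h] Suc.IH that by (simp add: algebra_simps)
  qed
  have le: "d t \<le> C * t * (d (t / real (Suc n)) / (t / real (Suc n)))" for n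
  proof -
    have eq: "real (Suc n) * (t / real (Suc n)) = t" by simp
    have "d t \<le> real (Suc n) * (C * d (t / real (Suc n)))"
      using iter[of "t / real (Suc n)" "Suc n"] t unfolding eq by simp
    also have "\<dots> = C * t * (d (t / real (Suc n)) / (t / real (Suc n)))"
      using t by simp
    finally show ?thesis .
  qed
  have lim: "(\<lambda>n. C * t * (d (t / real (Suc n)) / (t / real (Suc n)))) \<longlonglongrightarrow> C * t * 0"
  proof (intro tendsto_mult_left)
    have "filterlim (\<lambda>n. t / real (Suc n)) (at_right 0) sequentially"
    proof (rule tendsto_imp_filterlim_at_right)
      show "(\<lambda>n. t / real (Suc n)) \<longlonglongrightarrow> 0"
        using tendsto_mult_left[OF LIMSEQ_inverse_real_of_nat, of t] by (simp add: divide_inverse)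
    qed (use t in auto)
    with generator_eigenvector_defect[OF T e gen, folded d_def]
    show "(\<lambda>n. d (t / real (Suc n)) / (t / real (Suc n))) \<longlonglongrightarrow> 0"
      by (rule filterlim_compose)
  qed
  have "d t \<le> C * t * 0"
    by (rule LIMSEQ_le_const[OF lim]) (use le in blast)
  moreover have "0 \<le> d t"
    by (simp add: d_def L2_norm_nonneg)
  ultimately have "d t = 0"
    by simp
  then have "AE x in lebesgue_on D. T t e x - of_real (exp (- \<mu> * t)) * e x = 0"
    unfolding d_def using t by (intro L2_norm_eq_0_AE L2_diff L2_cmult Tcl e) auto
  then show ?thesis by simp
qed

text \<open>An eigenvector of the generator is an eigenvector of every operator of the semigroup. Short times
  are covered by the previous lemma; a long time is a multiple of a short one.\<close>
lemma C0_semigroup_eigenvector: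
  assumes T: "C0_semigroup D T" and e: "e \<in> L2 D" and \<mu>: "0 \<le> \<mu>"
    and gen: "generator D T e (\<lambda>x. - complex_of_real \<mu> * e x)" and t: "0 \<le> t"
  shows "AE x in lebesgue_on D. T t e x = of_real (exp (- \<mu> * t)) * e x"
proof -
  obtain \<delta> C where dC: "0 < \<delta>" "0 < C"
    "\<And>t u. 0 \<le> t \<Longrightarrow> t \<le> \<delta> \<Longrightarrow> u \<in> L2 D \<Longrightarrow> L2_norm D (T t u) \<le> C * L2_norm D u"
    by (rule C0_semigroup_locally_bounded[OF T]) blast
  obtain n :: nat where n: "t / \<delta> < real n"
    using reals_Archimedean2 by blast
  have "0 \<le> t / \<delta>" using t dC(1) by simp
  with n have n0: "0 < n" by (cases n) auto
  define h where "h = t / real n"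
  have h: "0 \<le> h" "h \<le> \<delta>"
    using n n0 t dC(1) by (auto simp: h_def field_simps)
  note op = C0_semigroup_operator[OF T]
  have Teh: "AE x in lebesgue_on D. T h e x = of_real (exp (- \<mu> * h)) * e x"
  proof (cases "h = 0")
    case True
    then show ?thesis using T e by (simp add: C0_semigroup_def)
  next
    case False
    then show ?thesis
      using C0_semigroup_eigenvector_small[OF T e \<mu> gen dC(2,3)] h by simp
  qed
  have "AE x in lebesgue_on D. T (real j * h) e x = of_real (exp (- \<mu> * (real j * h))) * e x" for j
  proof (induction j)
    case 0
    then show ?case using T e by (simp add: C0_semigroup_def)
  next
    case (Suc j)
    have jh: "0 \<le> real j * h" using h by simp
    have step: "AE x in lebesgue_on D. T (h + real j * h) e x = T h (T (real j * h) e) x"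
      using T e h jh by (simp add: C0_semigroup_def)
    have cong: "AE x in lebesgue_on D. T h (T (real j * h) e) x
        = T h (\<lambda>x. of_real (exp (- \<mu> * (real j * h))) * e x) x"
      by (rule L2_operator_cong[OF op[OF h(1)] L2_operator_closed[OF op[OF jh] e] L2_cmult[OF e] Suc])
    have scale: "AE x in lebesgue_on D. T h (\<lambda>x. of_real (exp (- \<mu> * (real j * h))) * e x) x
        = of_real (exp (- \<mu> * (real j * h))) * T h e x"
      by (rule L2_operator_cmult[OF op[OF h(1)] e])
    have j: "real (Suc j) * h = h + real j * h"
      by (simp add: algebra_simps)
    have exp_eq: "complex_of_real (exp (- \<mu> * (h + real j * h)))
        = of_real (exp (- \<mu> * (real j * h))) * of_real (exp (- \<mu> * h))"
      unfolding of_real_mult[symmetric] exp_add[symmetric] by (simp add: algebra_simps)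
    show ?case
      unfolding j exp_eq using step cong scale Teh by eventually_elim (simp only: mult.assoc)
  qed
  from this[of n] show ?thesis
    using n0 by (simp add: h_def)
qed

section \<open>Characters of the periodic box\<close>

text \<open>The frequencies \<open>\<omega>\<close> for which \<open>x \<mapsto> e\<^sup>i\<^sup>\<omega>\<^sup>\<cdot>\<^sup>x\<close> has the periods of the box.\<close>
definition dual_lattice :: "'a::euclidean_space \<Rightarrow> 'a \<Rightarrow> 'a set" where
  "dual_lattice a b = {\<omega>. \<forall>i\<in>Basis. \<exists>k::int. (\<omega> \<bullet> i) * ((b - a) \<bullet> i) = 2 * pi * of_int k}"

definition character :: "'a::euclidean_space \<Rightarrow> 'a \<Rightarrow> complex" where
  "character \<omega> x = cis (\<omega> \<bullet> x)"

lemma dual_lattice_zero: "0 \<in> dual_lattice a b"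
  by (auto simp: dual_lattice_def intro: exI[of _ 0])

lemma dual_lattice_add:
  assumes "\<omega> \<in> dual_lattice a b" "\<omega>' \<in> dual_lattice a b"
  shows "\<omega> + \<omega>' \<in> dual_lattice a b"
  unfolding dual_lattice_def
proof (intro CollectI ballI)
  fix i :: 'a assume "i \<in> Basis"
  then obtain k l :: int where "(\<omega> \<bullet> i) * ((b - a) \<bullet> i) = 2 * pi * k" "(\<omega>' \<bullet> i) * ((b - a) \<bullet> i) = 2 * pi * l"
    using assms unfolding dual_lattice_def by blast
  then show "\<exists>m::int. ((\<omega> + \<omega>') \<bullet> i) * ((b - a) \<bullet> i) = 2 * pi * m"
    by (intro exI[of _ "k + l"]) (simp add: inner_add_left distrib_right distrib_left)
qed

lemma dual_lattice_uminus:
  assumes "\<omega> \<in> dual_lattice a b"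
  shows "- \<omega> \<in> dual_lattice a b"
  unfolding dual_lattice_def
proof (intro CollectI ballI)
  fix i :: 'a assume "i \<in> Basis"
  then obtain k :: int where "(\<omega> \<bullet> i) * ((b - a) \<bullet> i) = 2 * pi * k"
    using assms by (auto simp: dual_lattice_def)
  then show "\<exists>m::int. (- \<omega> \<bullet> i) * ((b - a) \<bullet> i) = 2 * pi * m"
    by (intro exI[of _ "- k"]) simp
qed

lemma dual_lattice_basis:
  assumes "i \<in> Basis" "a \<bullet> i < b \<bullet> i"
  shows "(2 * pi / ((b - a) \<bullet> i)) *\<^sub>R i \<in> dual_lattice a b"
  unfolding dual_lattice_def
proof (intro CollectI ballI)
  fix j :: 'a assume "j \<in> Basis"
  then show "\<exists>m::int. ((2 * pi / ((b - a) \<bullet> i)) *\<^sub>R i \<bullet> j) * ((b - a) \<bullet> j) = 2 * pi * m"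
    using assms by (intro exI[of _ "if i = j then 1 else 0"]) (auto simp: inner_Basis inner_diff_left)
qed

lemma character_mult: "character \<omega> x * character \<omega>' x = character (\<omega> + \<omega>') x"
  by (simp add: character_def cis_mult inner_add_left)

lemma cnj_character: "cnj (character \<omega> x) = character (- \<omega>) x"
  by (simp add: character_def cis_cnj)

lemma norm_character [simp]: "norm (character \<omega> x) = 1"
  by (simp add: character_def)

lemma continuous_on_character: "continuous_on S (character \<omega>)"
proof -
  have "continuous_on S (\<lambda>x. exp (\<i> * complex_of_real (\<omega> \<bullet> x)))"
    by (intro continuous_intros)
  then show ?thesis
    by (simp add: character_def[abs_def] cis_conv_exp)
qed

lemma L2_bounded:
  fixes u :: "'a::euclidean_space \<Rightarrow> complex"
  assumes "D \<in> lmeasurable" "u \<in> borel_measurable (lebesgue_on D)" "\<And>x. x \<in> D \<Longrightarrow> norm (u x) \<le> B"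
  shows "u \<in> L2 D"
proof (rule L2_dominated[OF assms(2)])
  interpret finite_measure "lebesgue_on D"
    by (rule finite_measure_lebesgue_on[OF assms(1)])
  show "integrable (lebesgue_on D) (\<lambda>_. B\<^sup>2)"
    by (rule integrable_const)
  show "AE x in lebesgue_on D. (norm (u x))\<^sup>2 \<le> B\<^sup>2"
    using assms(3) by (intro AE_I2 power_mono) auto
qed

lemma character_measurable: "character \<omega> \<in> borel_measurable (lebesgue_on (box a b))"
  by (intro continuous_imp_measurable_on_sets_lebesgue continuous_on_character) simp

lemma character_L2: "character \<omega> \<in> L2 (box a b)"
  by (rule L2_bounded[OF _ character_measurable, of _ _ _ 1]) simp_all

lemma character_deriv:
  "((\<lambda>s. c * character \<omega> (x + s *\<^sub>R i)) has_vector_derivative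
      (c * (\<i> * of_real (\<omega> \<bullet> i))) * character \<omega> x) (at 0)"
proof -
  have "((\<lambda>z. c * exp (\<i> * (of_real (\<omega> \<bullet> x) + z * of_real (\<omega> \<bullet> i)))) has_field_derivative
      (c * (\<i> * of_real (\<omega> \<bullet> i))) * character \<omega> x) (at (of_real 0))"
    by (auto intro!: derivative_eq_intros simp: character_def cis_conv_exp)
  from has_vector_derivative_real_field[OF this] show ?thesis
    by (simp add: character_def cis_conv_exp inner_add_right)
qed

lemma partial_deriv_character:
  "partial_deriv i (\<lambda>x. c * character \<omega> x) = (\<lambda>x. (c * (\<i> * of_real (\<omega> \<bullet> i))) * character \<omega> x)"
  unfolding partial_deriv_def by (intro ext vector_derivative_at character_deriv)

text \<open>Partial derivatives only change the constant factor, so smoothness of all orders follows by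
  induction over multiples of a character.\<close>
lemma C_k_character: "C_k k (\<lambda>x. c * character \<omega> x)"
proof (induction k arbitrary: c)
  case 0
  show ?case by (auto intro!: continuous_intros continuous_on_character)
next
  case (Suc k)
  have "(\<lambda>s. c * character \<omega> (x + s *\<^sub>R i)) differentiable (at 0)" for x i
    using character_deriv by (rule differentiableI_vector)
  then show ?case
    using Suc by (auto simp: partial_deriv_character intro!: continuous_intros continuous_on_character)
qed

lemma smooth_periodic_character:
  assumes "\<omega> \<in> dual_lattice a b"
  shows "smooth_periodic a b (character \<omega>)"
  unfolding smooth_periodic_def
proof (intro conjI allI ballI)
  show "C_k k (character \<omega>)" for k
    using C_k_character[of k 1 \<omega>] by simp
  fix i x :: 'a assume "i \<in> Basis"
  then obtain k :: int where k: "(\<omega> \<bullet> i) * ((b - a) \<bullet> i) = 2 * pi * of_int k"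
    using assms by (auto simp: dual_lattice_def)
  have "character \<omega> (x + ((b - a) \<bullet> i) *\<^sub>R i) = cis (\<omega> \<bullet> x) * cis ((\<omega> \<bullet> i) * ((b - a) \<bullet> i))"
    by (simp add: character_def cis_mult inner_add_right mult.commute)
  then show "character \<omega> (x + ((b - a) \<bullet> i) *\<^sub>R i) = character \<omega> x"
    unfolding k by (simp add: character_def)
qed

lemma laplacian_character: "laplacian (character \<omega>) x = - complex_of_real (\<omega> \<bullet> \<omega>) * character \<omega> x"
proof -
  have "partial_deriv i (partial_deriv i (character \<omega>)) x = - complex_of_real ((\<omega> \<bullet> i) * (\<omega> \<bullet> i)) * character \<omega> x" for i
  proof -
    have "partial_deriv i (character \<omega>) = (\<lambda>x. (\<i> * of_real (\<omega> \<bullet> i)) * character \<omega> x)"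
      using partial_deriv_character[of i 1 \<omega>] by simp
    then show ?thesis
      by (simp only: partial_deriv_character) (simp add: algebra_simps)
  qed
  then show ?thesis
    unfolding laplacian_def euclidean_inner[of \<omega> \<omega>]
    by (simp add: sum_distrib_right sum_negf del: of_real_mult)
qed

text \<open>A character is itself smooth and periodic, so a constant approximating sequence shows that it
  lies in the domain of the closure.\<close>
lemma periodic_laplacian_character:
  assumes "\<omega> \<in> dual_lattice a b"
  shows "periodic_laplacian a b (character \<omega>) (\<lambda>x. - complex_of_real (\<omega> \<bullet> \<omega>) * character \<omega> x)"
  unfolding periodic_laplacian_def
proof (intro conjI exI[of _ "\<lambda>_. character \<omega>"] allI)
  show "smooth_periodic a b (character \<omega>)"
    by (rule smooth_periodic_character[OF assms])
qed (simp_all only: laplacian_character character_L2 L2_cmult, simp_all add: L2_norm_def)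

lemma heat_semigroup_character:
  assumes "heat_semigroup a b T" "\<omega> \<in> dual_lattice a b" "0 \<le> t"
  shows "AE x in lebesgue_on (box a b). T t (character \<omega>) x = of_real (exp (- (\<omega> \<bullet> \<omega>) * t)) * character \<omega> x"
  using assms periodic_laplacian_character[OF assms(2)]
  by (intro C0_semigroup_eigenvector) (auto simp: heat_semigroup_def character_L2)

lemma integral_cis_period:
  assumes \<theta>: "\<theta> \<noteq> 0" "\<theta> * (d - c) = 2 * pi * of_int k" and cd: "c \<le> d"
  shows "(LINT t|lborel. indicator {c<..<d} t *\<^sub>R cis (\<theta> * t)) = 0"
proof -
  define w where "w = \<i> * complex_of_real \<theta>"
  have w: "w \<noteq> 0" and cis_w: "cis (\<theta> * t) = exp (w * of_real t)" for t
    using \<theta> by (simp_all add: w_def cis_conv_exp mult.assoc)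
  define F where "F t = cis (\<theta> * t) / w" for t
  have F: "(F has_vector_derivative cis (\<theta> * t)) (at t within {c..d})" for t
  proof -
    have "((\<lambda>z. exp (w * z) / w) has_field_derivative exp (w * of_real t)) (at (of_real t))"
      using w by (auto intro!: derivative_eq_intros)
    from has_vector_derivative_real_field[OF this] show ?thesis
      by (simp add: F_def[abs_def] cis_w has_vector_derivative_at_within)
  qed
  have AE: "AE t in lborel. indicator {c<..<d} t *\<^sub>R cis (\<theta> * t) = indicator {c..d} t *\<^sub>R cis (\<theta> * t)"
    using AE_lborel_singleton[of c] AE_lborel_singleton[of d]
    by eventually_elim (auto simp: indicator_def)
  have cont: "continuous_on S (\<lambda>t. cis (\<theta> * t))" for S
    by (auto simp: cis_conv_exp intro!: continuous_intros)
  have meas: "(\<lambda>t. cis (\<theta> * t)) \<in> borel_measurable lborel"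
    using borel_measurable_continuous_onI[OF cont] by simp
  have "(LINT t|lborel. indicator {c<..<d} t *\<^sub>R cis (\<theta> * t)) = (LINT t|lborel. indicator {c..d} t *\<^sub>R cis (\<theta> * t))"
    by (rule integral_cong_AE[OF _ _ AE]) (intro borel_measurable_scaleR borel_measurable_indicator meas; simp)+
  also have "\<dots> = F d - F c"
    by (rule integral_FTC_atLeastAtMost[OF cd F cont])
  also have "F d = F c"
  proof -
    have "cis (\<theta> * d) = cis (\<theta> * c) * cis (\<theta> * (d - c))"
      by (simp add: cis_mult algebra_simps)
    then show ?thesis unfolding \<theta>(2) by (simp add: F_def)
  qed
  finally show ?thesis by simp
qed

lemma cis_sum: "finite I \<Longrightarrow> cis (\<Sum>i\<in>I. f i) = (\<Prod>i\<in>I. cis (f i))"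
  by (induction I rule: finite_induct) (auto simp: cis_mult[symmetric])

text \<open>The character is a product of functions of one coordinate, so the integral over the box is a
  product of integrals over intervals. Some coordinate of \<open>\<omega>\<close> is nonzero, and in that coordinate a full
  number of periods is integrated.\<close>
lemma integral_character_eq_0:
  fixes a b :: "'a::euclidean_space"
  assumes ab: "\<forall>i\<in>Basis. a \<bullet> i < b \<bullet> i" and \<omega>: "\<omega> \<in> dual_lattice a b" "\<omega> \<noteq> 0"
  shows "(LINT x|lebesgue_on (box a b). character \<omega> x) = 0"
proof -
  define f where "f i t = indicator {a \<bullet> i<..<b \<bullet> i} t *\<^sub>R cis ((\<omega> \<bullet> i) * t)" for i :: 'a and t
  have cont: "continuous_on S (\<lambda>t. cis (r * t))" for S r
    by (auto simp: cis_conv_exp intro!: continuous_intros)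
  have f_meas [measurable]: "f i \<in> borel_measurable borel" for i
    unfolding f_def[abs_def]
    by (intro borel_measurable_scaleR borel_measurable_indicator borel_measurable_continuous_onI cont) simp
  have f_int: "integrable lborel (f i)" for i
  proof (rule Bochner_Integration.integrable_bound)
    show "integrable lborel (indicator {a \<bullet> i<..<b \<bullet> i} :: real \<Rightarrow> real)"
      by (cases "a \<bullet> i \<le> b \<bullet> i") auto
  qed (auto simp: f_def)
  have f_prod: "indicator (box a b) x *\<^sub>R character \<omega> x = (\<Prod>i\<in>Basis. f i (x \<bullet> i))" for x
  proof (cases "x \<in> box a b")
    case True
    then have "(\<Prod>i\<in>Basis. f i (x \<bullet> i)) = (\<Prod>i\<in>Basis. cis ((\<omega> \<bullet> i) * (x \<bullet> i)))"
      by (intro prod.cong) (auto simp: f_def mem_box)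
    also have "\<dots> = character \<omega> x"
      by (simp add: character_def euclidean_inner[of \<omega> x] cis_sum)
    finally show ?thesis using True by simp
  next
    case False
    then obtain i where "i \<in> Basis" "\<not> (a \<bullet> i < x \<bullet> i \<and> x \<bullet> i < b \<bullet> i)"
      by (auto simp: mem_box)
    then have "(\<Prod>i\<in>Basis. f i (x \<bullet> i)) = 0"
      by (intro prod_zero) (auto simp: f_def intro!: bexI[of _ i])
    then show ?thesis using False by simp
  qed
  have prod_meas: "(\<lambda>x::'a. (\<Prod>i\<in>Basis. f i (x \<bullet> i))) \<in> borel_measurable borel"
    by measurable
  interpret product_sigma_finite "\<lambda>_::'a. lborel :: real measure"
    by standard
  have "(LINT x|lebesgue_on (box a b). character \<omega> x) = (LINT x|lebesgue. indicator (box a b) x *\<^sub>R character \<omega> x)"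
    by (rule integral_restrict_space) simp
  also have "\<dots> = (LINT x|lborel. (\<Prod>i\<in>Basis. f i (x \<bullet> i)))"
    unfolding f_prod by (rule integral_completion) (use prod_meas in simp)
  also have "\<dots> = (LINT y|(\<Pi>\<^sub>M b\<in>Basis. lborel). (\<Prod>i\<in>Basis. f i ((\<Sum>b\<in>Basis. y b *\<^sub>R b) \<bullet> i)))"
    by (subst lborel_eq, rule integral_distr) (use prod_meas in \<open>auto intro!: borel_measurable_sum borel_measurable_scaleR\<close>)
  also have "\<dots> = (LINT y|(\<Pi>\<^sub>M b\<in>(Basis::'a set). lborel). (\<Prod>i\<in>Basis. f i (y i)))"
    by (intro Bochner_Integration.integral_cong prod.cong refl)
       (simp add: inner_sum_left inner_Basis sum.delta if_distrib cong: if_cong)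
  also have "\<dots> = (\<Prod>i\<in>Basis. (LINT t|lborel. f i t))"
    by (rule product_integral_prod) (auto intro: f_int)
  also have "\<dots> = 0"
  proof -
    obtain i where i: "i \<in> Basis" "\<omega> \<bullet> i \<noteq> 0"
      using \<omega>(2) by (metis euclidean_all_zero_iff)
    obtain k :: int where "(\<omega> \<bullet> i) * ((b - a) \<bullet> i) = 2 * pi * of_int k"
      using \<omega>(1) i(1) by (auto simp: dual_lattice_def)
    then have "(LINT t|lborel. f i t) = 0"
      unfolding f_def using i ab
      by (intro integral_cis_period[where k=k]) (auto simp: inner_diff_left less_imp_le)
    then show ?thesis using i(1) by (intro prod_zero) auto
  qed
  finally show ?thesis .
qed

lemma character_orthogonal:
  assumes ab: "\<forall>i\<in>Basis. a \<bullet> i < b \<bullet> i"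
    and "\<omega> \<in> dual_lattice a b" "\<omega>' \<in> dual_lattice a b" "\<omega> \<noteq> \<omega>'"
  shows "L2_inner (box a b) (character \<omega>) (character \<omega>') = 0"
  using integral_character_eq_0[OF ab dual_lattice_add[OF assms(2) dual_lattice_uminus[OF assms(3)]]] assms(4)
  by (simp add: L2_inner_def cnj_character character_mult)

section \<open>Density of trigonometric polynomials\<close>

inductive trig_poly :: "'a::euclidean_space \<Rightarrow> 'a \<Rightarrow> ('a \<Rightarrow> complex) \<Rightarrow> bool" for a b where
  character: "\<omega> \<in> dual_lattice a b \<Longrightarrow> trig_poly a b (\<lambda>x. c * character \<omega> x)"
| add: "trig_poly a b p \<Longrightarrow> trig_poly a b q \<Longrightarrow> trig_poly a b (\<lambda>x. p x + q x)"

lemma trig_poly_const: "trig_poly a b (\<lambda>x. c)"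
  using trig_poly.character[OF dual_lattice_zero, of a b c] by (simp add: character_def)

lemma trig_poly_sum:
  "(\<And>i. i \<in> I \<Longrightarrow> trig_poly a b (p i)) \<Longrightarrow> trig_poly a b (\<lambda>x. \<Sum>i\<in>I. p i x)"
  by (induction I rule: infinite_finite_induct) (auto intro: trig_poly_const trig_poly.add)

lemma trig_poly_mult:
  assumes "trig_poly a b p" "trig_poly a b q"
  shows "trig_poly a b (\<lambda>x. p x * q x)"
  using assms(1)
proof induction
  case (character \<omega> c)
  show ?case
    using assms(2)
  proof induction
    case (character \<omega>' c')
    show ?case
      using trig_poly.character[OF dual_lattice_add[OF \<open>\<omega> \<in> dual_lattice a b\<close> character], of "c * c'"]
      by (simp add: character_mult[symmetric] mult_ac)
  next
    case (add p q)
    then show ?case by (simp add: distrib_left trig_poly.add)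
  qed
next
  case (add p p')
  then show ?case by (simp add: distrib_right trig_poly.add)
qed

text \<open>Trigonometric polynomials form an algebra, so they can be substituted for the coordinates in a
  polynomial. This transports the theorem of Stone and Weierstrass to periodic functions.\<close>
lemma trig_poly_real_polynomial:
  fixes s :: "'a::euclidean_space \<Rightarrow> 'a"
  assumes "real_polynomial_function q" and s: "\<And>i. i \<in> Basis \<Longrightarrow> trig_poly a b (\<lambda>x. of_real (s x \<bullet> i))"
  shows "trig_poly a b (\<lambda>x. of_real (q (s x)))"
  using assms(1)
proof induction
  case (linear f)
  interpret bounded_linear f by fact
  have "complex_of_real (f (s x)) = (\<Sum>i\<in>Basis. of_real (s x \<bullet> i) * of_real (f i))" for x
  proof -
    have "f (s x) = f (\<Sum>i\<in>Basis. (s x \<bullet> i) *\<^sub>R i)"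
      by (simp add: euclidean_representation)
    also have "\<dots> = (\<Sum>i\<in>Basis. (s x \<bullet> i) * f i)"
      by (simp add: sum scaleR)
    finally show ?thesis by simp
  qed
  then show ?case
    using s by (auto intro!: trig_poly_sum trig_poly_mult trig_poly_const)
next
  case (mult f g)
  then show ?case by (simp add: trig_poly_mult)
qed (simp_all add: trig_poly_const trig_poly.add)

text \<open>By the product formula \<open>2 sin A sin B = cos (A - B) - cos (A + B)\<close> this is a trigonometric
  polynomial, although each of the two factors is only antiperiodic. On the box it is positive exactly
  for \<open>c < x \<bullet> i < d\<close>, when \<open>c < d\<close> lie between the endpoints of the side.\<close>
lemma trig_poly_sign_change:
  fixes a b :: "'a::euclidean_space"
  assumes "i \<in> Basis" "a \<bullet> i < b \<bullet> i"
  shows "trig_poly a b (\<lambda>x. of_real (2 * sin (pi * (x \<bullet> i - c) / ((b - a) \<bullet> i)) * sin (pi * (d - x \<bullet> i) / ((b - a) \<bullet> i))))"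
proof -
  define L where "L = (b - a) \<bullet> i"
  define \<omega> where "\<omega> = (2 * pi / L) *\<^sub>R i"
  define \<gamma> where "\<gamma> = - (pi * (c + d) / L)"
  have L: "L \<noteq> 0" using assms(2) by (simp add: L_def inner_diff_left)
  have \<omega>: "\<omega> \<in> dual_lattice a b"
    unfolding \<omega>_def L_def by (rule dual_lattice_basis[OF assms])
  have eq: "of_real (2 * sin (pi * (x \<bullet> i - c) / L) * sin (pi * (d - x \<bullet> i) / L))
      = ((cis \<gamma> / 2) * character \<omega> x + (cis (- \<gamma>) / 2) * character (- \<omega>) x) + of_real (- cos (pi * (d - c) / L))" for x
  proof -
    define A B where "A = pi * (x \<bullet> i - c) / L" and "B = pi * (d - x \<bullet> i) / L"
    have AB: "A + B = pi * (d - c) / L" "A - B = \<gamma> + \<omega> \<bullet> x"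
      using L by (simp_all add: A_def B_def \<gamma>_def \<omega>_def inner_commute field_simps)
    have "2 * sin A * sin B = cos (A - B) - cos (A + B)"
      by (simp add: cos_diff cos_add)
    moreover have "complex_of_real (cos y) = (cis y + cis (- y)) / 2" for y
      by (simp add: complex_eq_iff)
    then have "complex_of_real (cos (A - B)) = (cis (\<gamma> + \<omega> \<bullet> x) + cis (- (\<gamma> + \<omega> \<bullet> x))) / 2"
      unfolding AB(2) .
    ultimately show ?thesis
      unfolding A_def[symmetric] B_def[symmetric] AB(1)[symmetric]
      by (simp add: character_def cis_mult add_divide_distrib)
  qed
  show ?thesis
    unfolding L_def[symmetric] eq
    by (intro trig_poly.add trig_poly.character trig_poly_const dual_lattice_uminus \<omega>)
qed

lemma sin_pi_pos_iff:
  assumes "\<bar>t\<bar> < L"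
  shows "0 < sin (pi * t / L) \<longleftrightarrow> 0 < t" "sin (pi * t / L) < 0 \<longleftrightarrow> t < 0"
proof -
  have L: "0 < L" using assms by linarith
  have pos: "0 < sin (pi * u / L)" if "0 < u" "u < L" for u
  proof (rule sin_gt_zero)
    show "0 < pi * u / L" using that L by simp
    show "pi * u / L < pi" using that L by (simp add: field_simps)
  qed
  have neg: "sin (pi * u / L) < 0" if "u < 0" "- L < u" for u
    using pos[of "- u"] that by simp
  show "0 < sin (pi * t / L) \<longleftrightarrow> 0 < t" "sin (pi * t / L) < 0 \<longleftrightarrow> t < 0"
    using pos[of t] neg[of t] assms by (cases t "0::real" rule: linorder_cases; force)+
qed

definition closed_subspace :: "'a::euclidean_space set \<Rightarrow> ('a \<Rightarrow> complex) set \<Rightarrow> bool" where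
  "closed_subspace D S \<longleftrightarrow> S \<subseteq> L2 D \<and>
     (\<forall>u\<in>S. \<forall>v\<in>S. \<forall>c. (\<lambda>x. c * u x + v x) \<in> S) \<and>
     (\<forall>u v. (\<forall>n::nat. u n \<in> S) \<longrightarrow> v \<in> L2 D \<longrightarrow>
        (\<lambda>n. L2_norm D (\<lambda>x. u n x - v x)) \<longlonglongrightarrow> 0 \<longrightarrow> v \<in> S)"

context
  fixes a b :: "'a::euclidean_space" and S :: "('a \<Rightarrow> complex) set"
  assumes ab: "\<forall>i\<in>Basis. a \<bullet> i < b \<bullet> i"
    and S: "closed_subspace (box a b) S"
    and char: "\<And>\<omega>. \<omega> \<in> dual_lattice a b \<Longrightarrow> character \<omega> \<in> S"
begin

lemma subspace_L2: "u \<in> S \<Longrightarrow> u \<in> L2 (box a b)"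
  using S by (auto simp: closed_subspace_def)

lemma subspace_lincomb: "u \<in> S \<Longrightarrow> v \<in> S \<Longrightarrow> (\<lambda>x. c * u x + v x) \<in> S"
  using S by (simp add: closed_subspace_def)

lemma subspace_limit:
  "(\<And>n::nat. u n \<in> S) \<Longrightarrow> v \<in> L2 (box a b) \<Longrightarrow>
     (\<lambda>n. L2_norm (box a b) (\<lambda>x. u n x - v x)) \<longlonglongrightarrow> 0 \<Longrightarrow> v \<in> S"
  using S unfolding closed_subspace_def by blast

lemma subspace_zero: "(\<lambda>x. 0) \<in> S"
  using subspace_lincomb[OF char[OF dual_lattice_zero] char[OF dual_lattice_zero], of "-1"] by simp

lemma subspace_cmult: "u \<in> S \<Longrightarrow> (\<lambda>x. c * u x) \<in> S"
  using subspace_lincomb[OF _ subspace_zero] by simp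

lemma subspace_add: "u \<in> S \<Longrightarrow> v \<in> S \<Longrightarrow> (\<lambda>x. u x + v x) \<in> S"
  using subspace_lincomb[of u v 1] by simp

lemma subspace_sum: "(\<And>i. i \<in> I \<Longrightarrow> u i \<in> S) \<Longrightarrow> (\<lambda>x. \<Sum>i\<in>I. u i x) \<in> S"
  by (induction I rule: infinite_finite_induct) (auto intro: subspace_zero subspace_add)

lemma subspace_AE_cong:
  assumes "u \<in> S" "AE x in lebesgue_on (box a b). v x = u x"
  shows "v \<in> S"
proof (rule subspace_limit[of "\<lambda>_. u"])
  show v: "v \<in> L2 (box a b)"
    by (rule L2_AE_cong[OF _ subspace_L2[OF assms(1)] assms(2)]) simp
  have "L2_norm (box a b) (\<lambda>x. u x - v x) = L2_norm (box a b) (\<lambda>x. 0)"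
    by (rule L2_norm_cong[OF _ L2_diff[OF subspace_L2[OF assms(1)] v] L2_zero])
       (use assms(2) in \<open>auto elim: eventually_mono\<close>)
  then show "(\<lambda>_. L2_norm (box a b) (\<lambda>x. u x - v x)) \<longlonglongrightarrow> 0"
    by (simp add: L2_norm_def)
qed (fact assms(1))

lemma subspace_cong: "u \<in> S \<Longrightarrow> (\<And>x. x \<in> box a b \<Longrightarrow> v x = u x) \<Longrightarrow> v \<in> S"
  by (rule subspace_AE_cong) (auto intro: AE_I2)

lemma subspace_pointwise_limit:
  assumes u: "\<And>n. u n \<in> S" and w: "integrable (lebesgue_on (box a b)) w"
    and lim: "\<And>x. x \<in> box a b \<Longrightarrow> (\<lambda>n. u n x) \<longlonglongrightarrow> v x"
    and bound: "\<And>n x. x \<in> box a b \<Longrightarrow> (norm (u n x))\<^sup>2 \<le> w x"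
  shows "v \<in> S"
proof (rule subspace_limit[OF u])
  have um: "u n \<in> borel_measurable (lebesgue_on (box a b))" for n
    by (rule L2_measurable[OF subspace_L2[OF u]])
  have vm: "v \<in> borel_measurable (lebesgue_on (box a b))"
    by (rule borel_measurable_LIMSEQ_metric[OF um]) (use lim in auto)
  have AE_lim: "AE x in lebesgue_on (box a b). (\<lambda>n. u n x) \<longlonglongrightarrow> v x"
    using lim by (intro AE_I2) simp
  have AE_bound: "AE x in lebesgue_on (box a b). (norm (u n x))\<^sup>2 \<le> w x" for n
    using bound by (intro AE_I2) simp
  show "v \<in> L2 (box a b)"
    by (rule L2_dominated_convergence(2)[OF um vm w AE_lim AE_bound])
  show "(\<lambda>n. L2_norm (box a b) (\<lambda>x. u n x - v x)) \<longlonglongrightarrow> 0"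
    by (rule L2_dominated_convergence(3)[OF um vm w AE_lim AE_bound])
qed

lemma subspace_bounded_limit:
  assumes u: "\<And>n. u n \<in> S"
    and lim: "\<And>x. x \<in> box a b \<Longrightarrow> (\<lambda>n. u n x) \<longlonglongrightarrow> v x"
    and bound: "\<And>n x. x \<in> box a b \<Longrightarrow> norm (u n x) \<le> B"
  shows "v \<in> S"
proof (rule subspace_pointwise_limit[OF u _ lim])
  interpret finite_measure "lebesgue_on (box a b)"
    by (rule finite_measure_lebesgue_on) simp
  show "integrable (lebesgue_on (box a b)) (\<lambda>_. B\<^sup>2)"
    by (rule integrable_const)
  show "(norm (u n x))\<^sup>2 \<le> B\<^sup>2" if "x \<in> box a b" for n x
    by (intro power_mono bound that) simp
qed

lemma subspace_trig_poly: "trig_poly a b p \<Longrightarrow> p \<in> S"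
  by (induction rule: trig_poly.induct) (auto intro: subspace_cmult subspace_add char)

text \<open>Take for every coordinate the trigonometric polynomial that is positive exactly between the two
  faces, cut it off at slope \<open>n\<close> to values in \<open>[0, 1]\<close>, and multiply. These functions tend pointwise to the
  indicator of the sub-box. Each of them is a continuous function of finitely many bounded trigonometric
  polynomials, hence by Stone--Weierstrass within \<open>1/(n+1)\<close> of a trigonometric polynomial.\<close>
lemma subspace_subbox:
  assumes cd: "\<And>i. i \<in> Basis \<Longrightarrow> a \<bullet> i \<le> c \<bullet> i \<and> c \<bullet> i < d \<bullet> i \<and> d \<bullet> i \<le> b \<bullet> i"
  shows "(\<lambda>x. indicator (box c d) x) \<in> S"
proof -
  define s where "s i x = 2 * sin (pi * (x \<bullet> i - c \<bullet> i) / ((b - a) \<bullet> i)) * sin (pi * (d \<bullet> i - x \<bullet> i) / ((b - a) \<bullet> i))"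
    for i x :: 'a
  define s' where "s' x = (\<Sum>i\<in>Basis. s i x *\<^sub>R i)" for x
  have s'_inner: "s' x \<bullet> i = s i x" if "i \<in> Basis" for x i
    unfolding s'_def using that by (simp add: inner_sum_left inner_Basis if_distrib cong: if_cong)
  define ramp where "ramp t = min 1 (max 0 t)" for t :: real
  define H where "H n y = (\<Prod>i\<in>Basis. ramp (real n * (y \<bullet> i)))" for n and y :: 'a
  have H_cont: "continuous_on K (H n)" for K n
    unfolding H_def ramp_def by (intro continuous_intros)
  have H_bound: "\<bar>H n y\<bar> \<le> 1" for n y
  proof -
    have "0 \<le> H n y" unfolding H_def by (intro prod_nonneg) (auto simp: ramp_def)
    moreover have "H n y \<le> 1" unfolding H_def by (intro prod_le_1) (auto simp: ramp_def)
    ultimately show ?thesis by simp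
  qed
  have "norm (s' x) \<le> (\<Sum>i\<in>(Basis::'a set). 2)" for x
    unfolding s'_def
  proof (intro sum_norm_le)
    fix i :: 'a assume "i \<in> Basis"
    then show "norm (s i x *\<^sub>R i) \<le> 2"
      unfolding s_def using mult_mono[OF abs_sin_le_one abs_sin_le_one]
      by (simp add: abs_mult)
  qed
  then have s'_bounded: "s' x \<in> cball 0 (\<Sum>i\<in>(Basis::'a set). 2)" for x
    by (simp add: dist_norm)
  have "\<exists>q. real_polynomial_function q \<and> (\<forall>y\<in>cball 0 (\<Sum>i\<in>(Basis::'a set). 2). \<bar>H n y - q y\<bar> < inverse (real (Suc n)))" for n
  proof -
    obtain q where "real_polynomial_function q"
      "\<And>y. y \<in> cball 0 (\<Sum>i\<in>(Basis::'a set). 2) \<Longrightarrow> \<bar>H n y - q y\<bar> < inverse (real (Suc n))"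
      using Stone_Weierstrass_real_polynomial_function[OF compact_cball H_cont, of "inverse (real (Suc n))"]
      by (metis inverse_positive_iff_positive of_nat_0_less_iff zero_less_Suc)
    then show ?thesis by blast
  qed
  then obtain q where q: "\<And>n. real_polynomial_function (q n)"
    "\<And>n x. \<bar>H n (s' x) - q n (s' x)\<bar> < inverse (real (Suc n))"
    using s'_bounded by metis
  have s_pos: "0 < s i x \<longleftrightarrow> c \<bullet> i < x \<bullet> i \<and> x \<bullet> i < d \<bullet> i" if i: "i \<in> Basis" and x: "x \<in> box a b" for i x
  proof -
    have "a \<bullet> i < x \<bullet> i" "x \<bullet> i < b \<bullet> i" using x i by (auto simp: mem_box)
    then have L: "\<bar>x \<bullet> i - c \<bullet> i\<bar> < (b - a) \<bullet> i" "\<bar>d \<bullet> i - x \<bullet> i\<bar> < (b - a) \<bullet> i"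
      using cd[OF i] by (auto simp: inner_diff_left)
    have "0 < s i x \<longleftrightarrow> 0 < sin (pi * (x \<bullet> i - c \<bullet> i) / ((b - a) \<bullet> i)) * sin (pi * (d \<bullet> i - x \<bullet> i) / ((b - a) \<bullet> i))"
      unfolding s_def by (simp only: mult.assoc zero_less_mult_iff) simp
    also have "\<dots> \<longleftrightarrow> c \<bullet> i < x \<bullet> i \<and> x \<bullet> i < d \<bullet> i"
      unfolding zero_less_mult_iff sin_pi_pos_iff[OF L(1)] sin_pi_pos_iff[OF L(2)]
      using cd[OF i] by auto
    finally show ?thesis .
  qed
  have H_lim: "(\<lambda>n. H n (s' x)) \<longlonglongrightarrow> indicator (box c d) x" if x: "x \<in> box a b" for x
  proof (cases "x \<in> box c d")
    case True
    have "(\<lambda>n. ramp (real n * s i x)) \<longlonglongrightarrow> 1" if i: "i \<in> Basis" for i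
    proof (rule tendsto_eventually)
      have "0 < s i x" using s_pos[OF i x] True i by (auto simp: mem_box)
      then have "filterlim (\<lambda>n. real n * s i x) at_top sequentially"
        by (intro filterlim_at_top_mult_tendsto_pos[OF tendsto_const] filterlim_real_sequentially)
      then have "\<forall>\<^sub>F n in sequentially. 1 \<le> real n * s i x"
        by (simp add: filterlim_at_top)
      then show "\<forall>\<^sub>F n in sequentially. ramp (real n * s i x) = 1"
        by eventually_elim (simp add: ramp_def)
    qed
    then have "(\<lambda>n. \<Prod>i\<in>Basis. ramp (real n * s i x)) \<longlonglongrightarrow> (\<Prod>i\<in>(Basis::'a set). 1)"
      by (intro tendsto_prod)
    then show ?thesis
      using True by (simp add: H_def s'_inner cong: prod.cong)
  next
    case False
    then obtain i where i: "i \<in> Basis" "\<not> (c \<bullet> i < x \<bullet> i \<and> x \<bullet> i < d \<bullet> i)"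
      by (auto simp: mem_box)
    then have "s i x \<le> 0" using s_pos[OF i(1) x] by (meson not_le)
    then have "ramp (real n * (s' x \<bullet> i)) = 0" for n
      using i(1) by (simp add: s'_inner ramp_def mult_nonneg_nonpos)
    then have "H n (s' x) = 0" for n
      unfolding H_def using i(1) by (intro prod_zero) auto
    then show ?thesis using False by simp
  qed
  show ?thesis
  proof (rule subspace_bounded_limit[where u="\<lambda>n x. of_real (q n (s' x))" and B=2])
    show "(\<lambda>x. complex_of_real (q n (s' x))) \<in> S" for n
    proof (rule subspace_trig_poly, rule trig_poly_real_polynomial[OF q(1), of a b s'])
      fix i :: 'a assume i: "i \<in> Basis"
      show "trig_poly a b (\<lambda>x. complex_of_real (s' x \<bullet> i))"
        unfolding s'_inner[OF i] s_def using ab i by (intro trig_poly_sign_change) auto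
    qed
    fix x assume x: "x \<in> box a b"
    have "(\<lambda>n. H n (s' x) - q n (s' x)) \<longlonglongrightarrow> 0"
      by (rule Lim_null_comparison[OF _ LIMSEQ_inverse_real_of_nat])
         (use q(2)[THEN less_imp_le] in \<open>simp add: always_eventually\<close>)
    from tendsto_diff[OF H_lim[OF x] this] have "(\<lambda>n. q n (s' x)) \<longlonglongrightarrow> indicator (box c d) x"
      by simp
    then have "(\<lambda>n. complex_of_real (q n (s' x))) \<longlonglongrightarrow> of_real (indicator (box c d) x)"
      by (rule tendsto_of_real)
    then show "(\<lambda>n. complex_of_real (q n (s' x))) \<longlonglongrightarrow> indicator (box c d) x"
      by (simp add: indicator_def of_bool_def split: if_splits)
    fix n
    have "inverse (real (Suc n)) \<le> 1" by (simp add: field_simps)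
    then show "norm (complex_of_real (q n (s' x))) \<le> 2"
      using H_bound[of n "s' x"] q(2)[of n x] unfolding norm_of_real by linarith
  qed
qed

lemma subspace_indicator_box: "(\<lambda>x. indicator (box c d) x) \<in> S"
proof -
  define c' d' where "c' = (\<Sum>i\<in>Basis. max (a\<bullet>i) (c\<bullet>i) *\<^sub>R i)" and "d' = (\<Sum>i\<in>Basis. min (b\<bullet>i) (d\<bullet>i) *\<^sub>R i)"
  have eq: "box a b \<inter> box c d = box c' d'"
    unfolding c'_def d'_def by (rule box_Int_box)
  have inner: "c' \<bullet> i = max (a\<bullet>i) (c\<bullet>i)" "d' \<bullet> i = min (b\<bullet>i) (d\<bullet>i)" if "i \<in> Basis" for i
    using that by (simp_all add: c'_def d'_def)
  have "(\<lambda>x. indicator (box c' d') x) \<in> S"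
  proof (cases "\<forall>i\<in>Basis. c' \<bullet> i < d' \<bullet> i")
    case True
    then show ?thesis by (intro subspace_subbox) (auto simp: inner)
  next
    case False
    then have "box c' d' = {}" by (auto simp: box_eq_empty not_less)
    then show ?thesis using subspace_zero by simp
  qed
  then show ?thesis
    by (rule subspace_cong) (auto simp: eq[symmetric] indicator_def)
qed

text \<open>Boxes are stable under intersection and generate the Borel sets, and the sets with indicator in
  the subspace are closed under complements and disjoint countable unions.\<close>
lemma subspace_indicator_borel:
  assumes "A \<in> sets borel"
  shows "(\<lambda>x. indicator A x) \<in> S"
proof -
  let ?G = "range (\<lambda>(c, d). box c d :: 'a set)"
  have "Int_stable ?G"
    by (auto simp: Int_stable_def box_Int_box)
  moreover have "?G \<subseteq> Pow UNIV" by auto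
  moreover have "A \<in> sigma_sets UNIV ?G"
    using assms unfolding borel_eq_box by simp
  ultimately show ?thesis
  proof (induction rule: sigma_sets_induct_disjoint)
    case (basic A)
    then show ?case using subspace_indicator_box by auto
  next
    case empty
    show ?case using subspace_zero by simp
  next
    case (compl A)
    have "(\<lambda>x. (-1) * indicator A x + 1) \<in> S"
      using subspace_lincomb[OF compl(2) subspace_trig_poly[OF trig_poly_const]] .
    then show ?case
      by (rule subspace_cong) (auto simp: indicator_def)
  next
    case (union A)
    have part: "(\<Sum>k<n. indicator (A k) x) = (indicator (\<Union>k<n. A k) x :: complex)" for n x
      by (rule indicator_UN_disjoint[symmetric])
         (use union(1) in \<open>auto simp: disjoint_family_on_def\<close>)
    show ?case
    proof (rule subspace_bounded_limit[where u="\<lambda>n x. \<Sum>k<n. indicator (A k) x" and B=1])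
      show "(\<lambda>x. \<Sum>k<n. indicator (A k) x) \<in> S" for n
        by (intro subspace_sum union)
      show "norm (\<Sum>k<n. indicator (A k) x :: complex) \<le> 1" for n x
        unfolding part by (simp add: indicator_def)
      show "(\<lambda>n. \<Sum>k<n. indicator (A k) x :: complex) \<longlonglongrightarrow> indicator (\<Union> (range A)) x" for x
        unfolding part by (rule LIMSEQ_indicator_UN)
    qed
  qed
qed

lemma subspace_indicator_lebesgue:
  assumes "A \<in> sets lebesgue"
  shows "(\<lambda>x. indicator A x) \<in> S"
proof -
  obtain C N where CN: "fsigma C" "N \<in> null_sets lebesgue" "C \<union> N = A"
    using lebesgue_set_almost_fsigma[OF assms] by metis
  from CN(1) have "C \<in> sets borel"
    by cases (auto intro: borel_closed)
  then have "(\<lambda>x. indicator C x) \<in> S"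
    by (rule subspace_indicator_borel)
  then show ?thesis
  proof (rule subspace_AE_cong)
    have "AE x in lebesgue. x \<notin> N"
      by (rule AE_not_in[OF CN(2)])
    then have "AE x in lebesgue_on (box a b). x \<notin> N"
      by (subst AE_restrict_space_iff) (auto elim: eventually_mono)
    then show "AE x in lebesgue_on (box a b). indicator A x = (indicator C x :: complex)"
      by eventually_elim (use CN(3) in \<open>auto simp: indicator_def\<close>)
  qed
qed

text \<open>The characters span a dense subspace of \<open>L\<^sup>2\<close> of the box. Stated for closed subspaces, this
  is an induction principle: a property that is linear and closed need only be checked for characters.
  Indicators of measurable sets lie in the subspace, and \<open>u\<close> is a dominated limit of simple functions.\<close>
theorem closed_subspace_characters_eq_L2:
  assumes u: "u \<in> L2 (box a b)"
  shows "u \<in> S"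
proof -
  let ?M = "lebesgue_on (box a b)"
  obtain F where F: "\<And>n. simple_function ?M (F n)" "\<And>x. x \<in> box a b \<Longrightarrow> (\<lambda>n. F n x) \<longlonglongrightarrow> u x"
    "\<And>n x. x \<in> box a b \<Longrightarrow> dist (F n x) 0 \<le> 2 * dist (u x) 0"
    using borel_measurable_implies_sequence_metric[OF L2_measurable[OF u], of 0]
    unfolding space_lebesgue_on by metis
  show ?thesis
  proof (rule subspace_pointwise_limit[of F])
    show "F n \<in> S" for n
    proof (rule subspace_cong)
      have "F n -` {y} \<inter> space ?M \<in> sets lebesgue" for y
        using simple_functionD(2)[OF F(1)[of n], of "{y}"]
        by (auto simp: sets_restrict_space_iff)
      then show "(\<lambda>x. \<Sum>y\<in>F n ` space ?M. y * indicator (F n -` {y} \<inter> space ?M) x) \<in> S"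
        by (intro subspace_sum subspace_cmult subspace_indicator_lebesgue)
      show "F n x = (\<Sum>y\<in>F n ` space ?M. y * indicator (F n -` {y} \<inter> space ?M) x)" if "x \<in> box a b" for x
      proof -
        have "F n x = (\<Sum>y\<in>F n ` space ?M. indicator (F n -` {y} \<inter> space ?M) x *\<^sub>R y)"
          by (rule simple_function_indicator_representation_banach[OF F(1)]) (use that in simp)
        also have "\<dots> = (\<Sum>y\<in>F n ` space ?M. y * indicator (F n -` {y} \<inter> space ?M) x)"
          by (intro sum.cong refl) (simp add: indicator_def)
        finally show ?thesis .
      qed
    qed
    show "integrable ?M (\<lambda>x. 4 * (norm (u x))\<^sup>2)"
      using L2_integrable_norm_sq[OF u] by simp
    show "(norm (F n x))\<^sup>2 \<le> 4 * (norm (u x))\<^sup>2" if "x \<in> box a b" for n x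
      using power_mono[OF F(3)[OF that, of n], of 2] by (simp add: power_mult_distrib)
  qed (fact F(2))
qed

end

section \<open>Symmetry of the heat semigroup\<close>

lemma closed_subspace_symmetric_with:
  assumes A: "L2_operator D A" and u: "u \<in> L2 D"
  shows "closed_subspace D {v \<in> L2 D. L2_inner D (A v) u = L2_inner D v (A u)}"
  unfolding closed_subspace_def
proof (intro conjI ballI allI impI)
  note cl = L2_operator_closed[OF A]
  fix v w c assume "v \<in> {v \<in> L2 D. L2_inner D (A v) u = L2_inner D v (A u)}"
    "w \<in> {v \<in> L2 D. L2_inner D (A v) u = L2_inner D v (A u)}"
  then have v: "v \<in> L2 D" "L2_inner D (A v) u = L2_inner D v (A u)"
    and w: "w \<in> L2 D" "L2_inner D (A w) u = L2_inner D w (A u)" by auto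
  have vw: "(\<lambda>x. c * v x + w x) \<in> L2 D" by (rule L2_lincomb[OF v(1) w(1)])
  have "L2_inner D (A (\<lambda>x. c * v x + w x)) u = L2_inner D (\<lambda>x. c * A v x + A w x) u"
    by (rule L2_inner_cong[OF L2_operator_lincomb[OF A v(1) w(1)]]) (intro cl vw L2_lincomb v w u)+
  then show "(\<lambda>x. c * v x + w x) \<in> {v \<in> L2 D. L2_inner D (A v) u = L2_inner D v (A u)}"
    using vw v w u by (simp add: L2_inner_lincomb_left cl)
next
  note cl = L2_operator_closed[OF A]
  fix v w
  assume v: "\<forall>n::nat. v n \<in> {v \<in> L2 D. L2_inner D (A v) u = L2_inner D v (A u)}"
    and w: "w \<in> L2 D" and lim: "(\<lambda>n. L2_norm D (\<lambda>x. v n x - w x)) \<longlonglongrightarrow> 0"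
  have vL: "v n \<in> L2 D" and eq: "L2_inner D (A (v n)) u = L2_inner D (v n) (A u)" for n
    using v by auto
  have "(\<lambda>n. L2_inner D (A (v n)) u) \<longlonglongrightarrow> L2_inner D (A w) u"
    by (intro L2_inner_tendsto cl vL w u L2_operator_tendsto[OF A] lim)
  moreover have "(\<lambda>n. L2_inner D (v n) (A u)) \<longlonglongrightarrow> L2_inner D w (A u)"
    by (intro L2_inner_tendsto cl vL w u lim)
  ultimately show "w \<in> {v \<in> L2 D. L2_inner D (A v) u = L2_inner D v (A u)}"
    using w unfolding eq by (auto intro: LIMSEQ_unique)
qed auto

text \<open>On characters of frequencies \<open>\<omega>\<close> and \<open>\<omega>'\<close> both sides are the inner product of the two characters
  times the eigenvalue of one of them; this inner product vanishes unless \<open>\<omega> = \<omega>'\<close>. For a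
  fixed \<open>u\<close> the identity is linear and closed in \<open>v\<close>, so density extends it first in one argument and then in the other.\<close>
theorem heat_semigroup_symmetric:
  assumes ab: "\<forall>i\<in>Basis. a \<bullet> i < b \<bullet> i" and T: "heat_semigroup a b T" and t: "0 \<le> t"
    and u: "u \<in> L2 (box a b)" and v: "v \<in> L2 (box a b)"
  shows "L2_inner (box a b) (T t v) u = L2_inner (box a b) v (T t u)"
proof -
  let ?D = "box a b" and ?A = "T t"
  have A: "L2_operator ?D ?A"
    using T t by (auto simp: heat_semigroup_def intro: C0_semigroup_operator)
  note cl = L2_operator_closed[OF A]
  have char: "L2_inner ?D (?A (character \<omega>)) (character \<omega>') = L2_inner ?D (character \<omega>) (?A (character \<omega>'))"
    if \<omega>: "\<omega> \<in> dual_lattice a b" "\<omega>' \<in> dual_lattice a b" for \<omega> \<omega>'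
  proof -
    have left: "L2_inner ?D (?A (character \<omega>)) (character \<omega>')
        = of_real (exp (- (\<omega> \<bullet> \<omega>) * t)) * L2_inner ?D (character \<omega>) (character \<omega>')"
      if "\<omega> \<in> dual_lattice a b" for \<omega> \<omega>'
    proof -
      have "L2_inner ?D (?A (character \<omega>)) (character \<omega>')
          = L2_inner ?D (\<lambda>x. of_real (exp (- (\<omega> \<bullet> \<omega>) * t)) * character \<omega> x) (character \<omega>')"
        by (rule L2_inner_cong[OF heat_semigroup_character[OF T that t]])
           (intro cl character_L2 L2_cmult)+
      also have "\<dots> = of_real (exp (- (\<omega> \<bullet> \<omega>) * t)) * L2_inner ?D (character \<omega>) (character \<omega>')"
        using L2_inner_lincomb_left[OF character_L2 L2_zero character_L2, of a b _ \<omega> \<omega>']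
        by (simp add: L2_inner_def)
      finally show ?thesis .
    qed
    have right: "L2_inner ?D (character \<omega>) (?A (character \<omega>'))
        = of_real (exp (- (\<omega>' \<bullet> \<omega>') * t)) * L2_inner ?D (character \<omega>) (character \<omega>')"
      using arg_cong[OF left[OF \<omega>(2), of \<omega>], of cnj]
      by (simp add: L2_inner_commute[of ?D "character \<omega>"] del: of_real_exp)
    show ?thesis
    proof (cases "\<omega> = \<omega>'")
      case True
      then show ?thesis
        unfolding left[OF \<omega>(1)] right by simp
    next
      case False
      then show ?thesis
        unfolding left[OF \<omega>(1)] right character_orthogonal[OF ab \<omega> False] by simp
    qed
  qed
  \<comment> \<open>density in the first argument, with a character in the second\<close>
  have char_all: "L2_inner ?D (?A w) (character \<omega>) = L2_inner ?D w (?A (character \<omega>))"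
    if "\<omega> \<in> dual_lattice a b" "w \<in> L2 ?D" for \<omega> w
    using closed_subspace_characters_eq_L2[OF ab closed_subspace_symmetric_with[OF A character_L2] _ that(2)]
      char that(1) by (simp add: character_L2)
  have "L2_inner ?D (?A (character \<omega>)) u = L2_inner ?D (character \<omega>) (?A u)" if "\<omega> \<in> dual_lattice a b" for \<omega>
    using char_all[OF that u] L2_inner_commute[of ?D "?A (character \<omega>)" u] L2_inner_commute[of ?D "character \<omega>" "?A u"]
    by simp
  then show ?thesis
    using closed_subspace_characters_eq_L2[OF ab closed_subspace_symmetric_with[OF A u] _ v]
    by (simp add: character_L2)
qed

section \<open>The truncated nonlinearity\<close>

text \<open>The radial function \<open>6 M\<^sup>2 r\<^sup>2 - F\<close> for the truncated nonlinearity \<open>F\<close>. The truncation continues \<open>r\<^sup>4\<close>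
  by its second-order Taylor polynomial at \<open>M\<close>, whose second derivative is \<open>12 M\<^sup>2\<close>; so beyond \<open>M\<close> this
  function is affine.\<close>
definition trunc_profile :: "real \<Rightarrow> real \<Rightarrow> real" where
  "trunc_profile M r = (if r \<le> M then 6 * M\<^sup>2 * r\<^sup>2 - r ^ 4 else 8 * M ^ 3 * r - 3 * M ^ 4)"

definition trunc_profile_slope :: "real \<Rightarrow> real \<Rightarrow> real" where
  "trunc_profile_slope M r = (if r \<le> M then 12 * M\<^sup>2 * r - 4 * r ^ 3 else 8 * M ^ 3)"

lemma trunc_profile_slope_nonneg:
  assumes "0 \<le> r" "0 \<le> M"
  shows "0 \<le> trunc_profile_slope M r"
proof (cases "r \<le> M")
  case True
  then have "r\<^sup>2 \<le> M\<^sup>2" using assms by (intro power_mono) auto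
  then have "0 \<le> 3 * M\<^sup>2 - r\<^sup>2"
    using zero_le_power2[of M] by linarith
  then have "0 \<le> 4 * r * (3 * M\<^sup>2 - r\<^sup>2)"
    using assms by (intro mult_nonneg_nonneg) auto
  then show ?thesis using True
    by (simp add: trunc_profile_slope_def power2_eq_square power3_eq_cube algebra_simps)
qed (use assms in \<open>simp add: trunc_profile_slope_def\<close>)

text \<open>Convexity, as the supporting line at \<open>r\<close>. Below \<open>M\<close> the gap is
  \<open>(s - r)\<^sup>2 (6 M\<^sup>2 - (s\<^sup>2 + 2 r s + 3 r\<^sup>2)) \<ge> 0\<close>. Beyond \<open>M\<close> the function continues along its tangent at
  \<open>M\<close>, and a comparison at \<open>M\<close> together with monotonicity of the slope settles the mixed cases.\<close>
lemma trunc_profile_convex: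
  assumes r: "0 \<le> r" and s: "0 \<le> s" and M: "0 \<le> M"
  shows "trunc_profile M r + trunc_profile_slope M r * (s - r) \<le> trunc_profile M s"
proof -
  have poly: "6 * M\<^sup>2 * r\<^sup>2 - r ^ 4 + (12 * M\<^sup>2 * r - 4 * r ^ 3) * (s - r) \<le> 6 * M\<^sup>2 * s\<^sup>2 - s ^ 4"
    if "0 \<le> r" "r \<le> M" "0 \<le> s" "s \<le> M" for r s
  proof -
    have "s\<^sup>2 \<le> M\<^sup>2" "r\<^sup>2 \<le> M\<^sup>2" "r * s \<le> M * M"
      using that by (auto intro: power_mono mult_mono)
    then have "0 \<le> (s - r)\<^sup>2 * (6 * M\<^sup>2 - (s\<^sup>2 + 2 * (r * s) + 3 * r\<^sup>2))"
      by (intro mult_nonneg_nonneg) (auto simp: power2_eq_square)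
    also have "\<dots> = 6 * M\<^sup>2 * s\<^sup>2 - s ^ 4 - (6 * M\<^sup>2 * r\<^sup>2 - r ^ 4 + (12 * M\<^sup>2 * r - 4 * r ^ 3) * (s - r))"
      by (simp add: power2_eq_square power3_eq_cube power4_eq_xxxx algebra_simps)
    finally show ?thesis by simp
  qed
  have M4: "6 * M\<^sup>2 * M\<^sup>2 - M ^ 4 = 5 * M ^ 4" "12 * M\<^sup>2 * M - 4 * M ^ 3 = 8 * M ^ 3" "M ^ 3 * M = M ^ 4"
    by (simp_all add: power2_eq_square power3_eq_cube power4_eq_xxxx)
  consider "r \<le> M" "s \<le> M" | "r \<le> M" "M < s" | "M < r" "s \<le> M" | "M < r" "M < s" by linarith
  then show ?thesis
  proof cases
    case 1
    then show ?thesis using poly[OF r _ s] by (simp add: trunc_profile_def trunc_profile_slope_def)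
  next
    case 2
    have "12 * M\<^sup>2 * r - 4 * r ^ 3 \<le> 8 * M ^ 3"
    proof -
      have "0 \<le> 4 * ((M - r)\<^sup>2 * (2 * M + r))"
        using r M by simp
      also have "\<dots> = 8 * M ^ 3 - (12 * M\<^sup>2 * r - 4 * r ^ 3)"
        by (simp add: power2_eq_square power3_eq_cube algebra_simps)
      finally show ?thesis by simp
    qed
    then have "(12 * M\<^sup>2 * r - 4 * r ^ 3) * (s - M) \<le> 8 * M ^ 3 * (s - M)"
      using 2 by (intro mult_right_mono) auto
    moreover have "(12 * M\<^sup>2 * r - 4 * r ^ 3) * (s - r)
        = (12 * M\<^sup>2 * r - 4 * r ^ 3) * (M - r) + (12 * M\<^sup>2 * r - 4 * r ^ 3) * (s - M)"
      by (simp add: algebra_simps)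
    moreover have "6 * M\<^sup>2 * r\<^sup>2 - r ^ 4 + (12 * M\<^sup>2 * r - 4 * r ^ 3) * (M - r) \<le> 5 * M ^ 4"
      using poly[OF r 2(1) M order_refl] unfolding M4 .
    moreover have "8 * M ^ 3 * (s - M) = 8 * M ^ 3 * s - 8 * M ^ 4"
      using M4(3) by (simp add: right_diff_distrib mult.assoc)
    ultimately show ?thesis
      using 2 by (simp add: trunc_profile_def trunc_profile_slope_def)
  next
    case 3
    have "5 * M ^ 4 + 8 * M ^ 3 * (s - M) \<le> 6 * M\<^sup>2 * s\<^sup>2 - s ^ 4"
      using poly[OF M order_refl s 3(2)] unfolding M4 .
    moreover have "8 * M ^ 3 * (s - M) = 8 * M ^ 3 * s - 8 * M ^ 4"
      using M4(3) by (simp add: right_diff_distrib mult.assoc)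
    moreover have "8 * M ^ 3 * (s - r) = 8 * M ^ 3 * s - 8 * M ^ 3 * r"
      by (simp add: right_diff_distrib)
    ultimately show ?thesis
      using 3 by (simp add: trunc_profile_def trunc_profile_slope_def)
  next
    case 4
    then show ?thesis
      by (simp add: trunc_profile_def trunc_profile_slope_def right_diff_distrib)
  qed
qed

lemma trunc_F_eq_profile: "trunc_F M z = 6 * M\<^sup>2 * (norm z)\<^sup>2 - trunc_profile M (norm z)"
  by (simp add: trunc_F_def trunc_profile_def)

lemma trunc_f_eq_profile:
  assumes "0 \<le> M"
  shows "trunc_f M z = of_real (12 * M\<^sup>2) * z - of_real (trunc_profile_slope M (norm z)) * sgn z"
proof (cases "z = 0")
  case True
  then show ?thesis using assms by (simp add: trunc_f_def)
next
  case False
  then have z: "z = of_real (norm z) * sgn z"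
    by (simp add: sgn_eq)
  show ?thesis
  proof (cases "norm z \<le> M")
    case True
    have "of_real (trunc_profile_slope M (norm z)) * sgn z
        = (of_real (12 * M\<^sup>2) - 4 * of_real ((norm z)\<^sup>2)) * (of_real (norm z) * sgn z)"
      using True by (simp add: trunc_profile_slope_def power2_eq_square power3_eq_cube algebra_simps)
    then show ?thesis
      using True unfolding z[symmetric] by (simp add: trunc_f_def algebra_simps)
  next
    case False
    then show ?thesis by (simp add: trunc_f_def trunc_profile_slope_def sgn_eq)
  qed
qed

text \<open>The function \<open>6 M\<^sup>2 \<bar>z\<bar>\<^sup>2 - F(z)\<close> is a convex nondecreasing function of \<open>\<bar>z\<bar>\<close>, hence convex on the
  plane, and \<open>f\<close> is the gradient of \<open>F\<close>. Its tangent inequality at \<open>u\<close> is the claim, after expanding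
  \<open>\<bar>v\<bar>\<^sup>2\<close> around \<open>u\<close>.\<close>
lemma trunc_F_upper_quadratic:
  assumes M: "0 \<le> M"
  shows "trunc_F M v \<le> trunc_F M u + Re (trunc_f M u * cnj (v - u)) + 6 * M\<^sup>2 * (norm (v - u))\<^sup>2"
proof -
  define k where "k = trunc_profile_slope M (norm u)"
  have k: "0 \<le> k" unfolding k_def by (rule trunc_profile_slope_nonneg[OF norm_ge_zero M])
  have sgn_u: "Re (sgn u * cnj u) = norm u"
  proof (cases "u = 0")
    case False
    have "sgn u * cnj u = of_real (norm u)"
      using False complex_norm_square[of u] by (simp add: sgn_eq divide_simps power2_eq_square)
    then show ?thesis by simp
  qed simp
  have "Re (sgn u * cnj v) \<le> norm (sgn u * cnj v)"
    by (rule complex_Re_le_cmod)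
  also have "\<dots> \<le> norm v"
    by (simp add: norm_mult norm_sgn)
  finally have "k * Re (sgn u * cnj v) \<le> k * norm v"
    using k by (rule mult_left_mono)
  then have slope: "k * Re (sgn u * cnj (v - u)) \<le> k * (norm v - norm u)"
    using sgn_u by (simp add: right_diff_distrib)
  have profile: "trunc_profile M (norm u) + k * (norm v - norm u) \<le> trunc_profile M (norm v)"
    unfolding k_def by (rule trunc_profile_convex[OF norm_ge_zero norm_ge_zero M])
  have Re_mult: "Re (complex_of_real c * z) = c * Re z" for c z
    by simp
  have "Re (trunc_f M u * cnj (v - u)) = 12 * M\<^sup>2 * Re (u * cnj (v - u)) - k * Re (sgn u * cnj (v - u))"
    unfolding trunc_f_eq_profile[OF M] k_def[symmetric]
    by (simp only: left_diff_distrib mult.assoc minus_complex.sel Re_mult)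
  moreover have "(norm v)\<^sup>2 = (norm u)\<^sup>2 + 2 * Re (u * cnj (v - u)) + (norm (v - u))\<^sup>2"
    by (simp only: cmod_power2) (simp add: power2_eq_square algebra_simps)
  then have "6 * M\<^sup>2 * (norm v)\<^sup>2 = 6 * M\<^sup>2 * (norm u)\<^sup>2 + 12 * M\<^sup>2 * Re (u * cnj (v - u)) + 6 * M\<^sup>2 * (norm (v - u))\<^sup>2"
    by (simp only: distrib_left)
  ultimately show ?thesis
    using slope profile unfolding trunc_F_eq_profile by linarith
qed

lemma abs_trunc_F_le:
  assumes M: "0 \<le> M"
  shows "\<bar>trunc_F M z\<bar> \<le> 17 * M\<^sup>2 * (norm z)\<^sup>2"
proof (cases "norm z \<le> M")
  case True
  have "norm z ^ 4 = (norm z)\<^sup>2 * (norm z)\<^sup>2"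
    by (simp add: power2_eq_square power4_eq_xxxx)
  also have "\<dots> \<le> M\<^sup>2 * (norm z)\<^sup>2"
    using True by (intro mult_right_mono power_mono) auto
  also have "\<dots> \<le> 17 * M\<^sup>2 * (norm z)\<^sup>2"
    by simp
  finally show ?thesis using True by (simp add: trunc_F_def)
next
  case False
  define r where "r = norm z"
  have r: "M < r" "0 \<le> r" using False by (auto simp: r_def)
  have a: "0 \<le> M ^ 3 * r" "M ^ 3 * r \<le> M\<^sup>2 * r\<^sup>2"
  proof -
    have "(M\<^sup>2 * r) * M \<le> (M\<^sup>2 * r) * r" using r M by (intro mult_left_mono) auto
    then show "M ^ 3 * r \<le> M\<^sup>2 * r\<^sup>2" by (simp add: power2_eq_square power3_eq_cube mult_ac)
  qed (use M r in simp)
  have b: "0 \<le> M ^ 4" "M ^ 4 \<le> M\<^sup>2 * r\<^sup>2"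
  proof -
    have "M\<^sup>2 * M\<^sup>2 \<le> M\<^sup>2 * r\<^sup>2" using r M by (intro mult_left_mono power_mono) auto
    then show "M ^ 4 \<le> M\<^sup>2 * r\<^sup>2" by (simp add: power2_eq_square power4_eq_xxxx mult_ac)
  qed simp
  have F: "trunc_F M z = 6 * (M\<^sup>2 * r\<^sup>2) - 8 * (M ^ 3 * r) + 3 * M ^ 4"
    using False by (simp add: trunc_F_def r_def)
  show ?thesis
    unfolding F r_def[symmetric] abs_le_iff mult.assoc using a b by (intro conjI) linarith+
qed

lemma norm_trunc_f_le:
  assumes M: "0 \<le> M"
  shows "norm (trunc_f M z) \<le> 20 * M\<^sup>2 * norm z"
proof (cases "norm z \<le> M")
  case True
  have "norm (trunc_f M z) = 4 * (norm z)\<^sup>2 * norm z"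
    using True by (simp add: trunc_f_def norm_mult norm_power)
  also have "\<dots> \<le> 20 * M\<^sup>2 * norm z"
    using power_mono[OF True norm_ge_zero, of 2] zero_le_power2[of M]
    by (intro mult_right_mono norm_ge_zero) linarith
  finally show ?thesis .
next
  case False
  then have "z \<noteq> 0" using M by auto
  have "norm (trunc_f M z) \<le> norm (12 * complex_of_real (M\<^sup>2) * z) + norm (8 * complex_of_real (M ^ 3) * (z / complex_of_real (norm z)))"
    using False by (simp add: trunc_f_def norm_triangle_ineq4 del: of_real_power)
  also have "\<dots> = 12 * M\<^sup>2 * norm z + 8 * M ^ 3"
    using \<open>z \<noteq> 0\<close> M by (simp add: norm_mult norm_divide norm_power)
  also have "M ^ 3 \<le> M\<^sup>2 * norm z"
    using False M mult_left_mono[of M "norm z" "M\<^sup>2"] by (simp add: power2_eq_square power3_eq_cube)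
  finally show ?thesis by (simp add: mult_ac)
qed

lemma trunc_F_measurable [measurable]: "trunc_F M \<in> borel_measurable borel"
  unfolding trunc_F_def[abs_def] by measurable

lemma trunc_f_measurable [measurable]: "trunc_f M \<in> borel_measurable borel"
  unfolding trunc_f_def[abs_def] by measurable

section \<open>Concavity of the truncated energy\<close>

text \<open>Symmetry and the semigroup law turn the cross term
  \<open>\<langle>e\<^sup>\<tau>\<^sup>\<Delta>\<^sup>/\<^sup>2 u, e\<^sup>\<tau>\<^sup>\<Delta>\<^sup>/\<^sup>2 (v - u)\<rangle>\<close> into \<open>\<langle>e\<^sup>\<tau>\<^sup>\<Delta> u, v - u\<rangle>\<close>, and the square of
  \<open>e\<^sup>\<tau>\<^sup>\<Delta>\<^sup>/\<^sup>2 (v - u)\<close> is dropped.\<close>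
lemma heat_energy_lower:
  assumes ab: "\<forall>i\<in>Basis. a \<bullet> i < b \<bullet> i" and T: "heat_semigroup a b T" and \<tau>: "0 < \<tau>"
    and u: "u \<in> L2 (box a b)" and v: "v \<in> L2 (box a b)"
  shows "(L2_norm (box a b) (T (\<tau> / 2) u))\<^sup>2 + 2 * Re (L2_inner (box a b) (T \<tau> u) (\<lambda>x. v x - u x))
           \<le> (L2_norm (box a b) (T (\<tau> / 2) v))\<^sup>2"
proof -
  let ?D = "box a b" and ?A = "T (\<tau> / 2)"
  have C0: "C0_semigroup ?D T" using T by (simp add: heat_semigroup_def)
  have A: "L2_operator ?D ?A" and A2: "L2_operator ?D (T \<tau>)"
    using \<tau> by (auto intro: C0_semigroup_operator[OF C0])
  note cl = L2_operator_closed[OF A]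
  define w where "w = (\<lambda>x. v x - u x)"
  have w: "w \<in> L2 ?D" unfolding w_def by (rule L2_diff[OF v u])
  have "AE x in lebesgue_on ?D. T (\<tau> / 2 + \<tau> / 2) u x = ?A (?A u) x"
    using C0 \<tau> u unfolding C0_semigroup_def by (meson less_imp_le half_gt_zero)
  then have half: "AE x in lebesgue_on ?D. T \<tau> u x = ?A (?A u) x"
    by simp
  have "L2_inner ?D (?A u) (?A w) = L2_inner ?D (?A (?A u)) w"
    using heat_semigroup_symmetric[OF ab T _ w cl[OF u], of "\<tau> / 2"] \<tau> by simp
  also have "\<dots> = L2_inner ?D (T \<tau> u) w"
    by (rule L2_inner_cong[symmetric, OF half L2_operator_closed[OF A2 u] cl[OF cl[OF u]] w])
  finally have cross: "L2_inner ?D (?A u) (?A w) = L2_inner ?D (T \<tau> u) w" .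
  have "AE x in lebesgue_on ?D. ?A v x = ?A u x + ?A w x"
    using L2_operator_add[OF A u w] by (simp add: w_def)
  then have "L2_norm ?D (?A v) = L2_norm ?D (\<lambda>x. ?A u x + ?A w x)"
    by (rule L2_norm_cong) (intro cl v u w L2_add)+
  then have "(L2_norm ?D (?A v))\<^sup>2 = (L2_norm ?D (?A u))\<^sup>2 + 2 * Re (L2_inner ?D (T \<tau> u) w) + (L2_norm ?D (?A w))\<^sup>2"
    by (simp add: L2_norm_add_power2[OF cl[OF u] cl[OF w]] cross)
  then show ?thesis unfolding w_def[symmetric] by simp
qed

definition potential_density :: "('a \<Rightarrow> real) \<Rightarrow> real \<Rightarrow> real \<Rightarrow> real \<Rightarrow> complex \<Rightarrow> 'a \<Rightarrow> real" where
  "potential_density V \<beta> \<kappa> M z x = V x * (norm z)\<^sup>2 + \<beta> / 2 * trunc_F M z - \<kappa> * (norm z)\<^sup>2"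

definition potential_gradient :: "('a \<Rightarrow> real) \<Rightarrow> real \<Rightarrow> real \<Rightarrow> real \<Rightarrow> complex \<Rightarrow> 'a \<Rightarrow> complex" where
  "potential_gradient V \<beta> \<kappa> M z x = 2 * of_real (V x) * z + of_real (\<beta> / 2) * trunc_f M z - 2 * of_real \<kappa> * z"

context
  fixes D :: "'a::euclidean_space set" and V :: "'a \<Rightarrow> real" and \<beta> \<kappa> M W :: real
  assumes V_meas: "V \<in> borel_measurable (lebesgue_on D)"
    and V_bounds: "AE x in lebesgue_on D. 0 \<le> V x \<and> V x \<le> W"
    and \<beta>: "0 \<le> \<beta>" and M: "0 \<le> M" and \<kappa>: "W + 3 * \<beta> * M\<^sup>2 \<le> \<kappa>"
begin

text \<open>Concavity of the potential part. The quadratic remainder is at most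
  \<open>(V - \<kappa> + 3 \<beta> M\<^sup>2) \<bar>v - u\<bar>\<^sup>2\<close>, and the lower bound on \<open>\<kappa>\<close> makes it nonpositive.\<close>
lemma potential_density_tangent:
  assumes V: "V x \<le> W"
  shows "potential_density V \<beta> \<kappa> M v x \<le> potential_density V \<beta> \<kappa> M u x + Re (potential_gradient V \<beta> \<kappa> M u x * cnj (v - u))"
proof -
  have sq: "(norm v)\<^sup>2 = (norm u)\<^sup>2 + 2 * Re (u * cnj (v - u)) + (norm (v - u))\<^sup>2"
    by (simp only: cmod_power2) (simp add: power2_eq_square algebra_simps)
  have Re_mult: "Re (complex_of_real c * z) = c * Re z" for c z
    by simp
  have "potential_gradient V \<beta> \<kappa> M u x * w
      = of_real (2 * V x - 2 * \<kappa>) * (u * w) + of_real (\<beta> / 2) * (trunc_f M u * w)" for w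
    by (simp add: potential_gradient_def algebra_simps)
  then have grad: "Re (potential_gradient V \<beta> \<kappa> M u x * cnj (v - u))
      = (2 * V x - 2 * \<kappa>) * Re (u * cnj (v - u)) + \<beta> / 2 * Re (trunc_f M u * cnj (v - u))"
    by (simp only: plus_complex.sel Re_mult)
  have "\<beta> / 2 * trunc_F M v \<le> \<beta> / 2 * (trunc_F M u + Re (trunc_f M u * cnj (v - u)) + 6 * M\<^sup>2 * (norm (v - u))\<^sup>2)"
    using \<beta> by (intro mult_left_mono trunc_F_upper_quadratic M) simp
  moreover have "(V x - \<kappa> + 3 * \<beta> * M\<^sup>2) * (norm (v - u))\<^sup>2 \<le> 0"
    using V \<kappa> by (intro mult_nonpos_nonneg) auto
  ultimately show ?thesis
    unfolding potential_density_def grad sq by (simp add: algebra_simps)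
qed

lemma V_mult_L2:
  assumes u: "u \<in> L2 D"
  shows "(\<lambda>x. of_real (V x) * u x) \<in> L2 D"
proof (rule L2_dominated)
  show "(\<lambda>x. of_real (V x) * u x) \<in> borel_measurable (lebesgue_on D)"
    using V_meas L2_measurable[OF u] by measurable
  show "integrable (lebesgue_on D) (\<lambda>x. W\<^sup>2 * (norm (u x))\<^sup>2)"
    using L2_integrable_norm_sq[OF u] by simp
  show "AE x in lebesgue_on D. (norm (of_real (V x) * u x))\<^sup>2 \<le> W\<^sup>2 * (norm (u x))\<^sup>2"
    using V_bounds
    by eventually_elim (simp add: norm_mult power_mult_distrib mult_right_mono power_mono)
qed

lemma trunc_f_L2:
  assumes u: "u \<in> L2 D"
  shows "(\<lambda>x. trunc_f M (u x)) \<in> L2 D"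
proof (rule L2_dominated)
  show "(\<lambda>x. trunc_f M (u x)) \<in> borel_measurable (lebesgue_on D)"
    using L2_measurable[OF u] by measurable
  show "integrable (lebesgue_on D) (\<lambda>x. (20 * M\<^sup>2)\<^sup>2 * (norm (u x))\<^sup>2)"
    using L2_integrable_norm_sq[OF u] by simp
  show "AE x in lebesgue_on D. (norm (trunc_f M (u x)))\<^sup>2 \<le> (20 * M\<^sup>2)\<^sup>2 * (norm (u x))\<^sup>2"
    unfolding power_mult_distrib[symmetric] by (intro AE_I2 power_mono norm_trunc_f_le M norm_ge_zero)
qed

lemma potential_gradient_L2:
  assumes u: "u \<in> L2 D"
  shows "(\<lambda>x. potential_gradient V \<beta> \<kappa> M (u x) x) \<in> L2 D"
proof -
  have "(\<lambda>x. 2 * (of_real (V x) * u x) + of_real (\<beta> / 2) * trunc_f M (u x) - (2 * of_real \<kappa>) * u x) \<in> L2 D"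
    by (intro L2_diff L2_add L2_cmult V_mult_L2 trunc_f_L2 u)
  then show ?thesis by (simp add: potential_gradient_def mult.assoc)
qed

lemma potential_density_integrable:
  assumes u: "u \<in> L2 D"
  shows "integrable (lebesgue_on D) (\<lambda>x. potential_density V \<beta> \<kappa> M (u x) x)"
  unfolding potential_density_def
proof (intro Bochner_Integration.integrable_add Bochner_Integration.integrable_diff)
  note int = L2_integrable_norm_sq[OF u]
  have um: "u \<in> borel_measurable (lebesgue_on D)" by (rule L2_measurable[OF u])
  show "integrable (lebesgue_on D) (\<lambda>x. V x * (norm (u x))\<^sup>2)"
  proof (rule Bochner_Integration.integrable_bound)
    show "integrable (lebesgue_on D) (\<lambda>x. W * (norm (u x))\<^sup>2)" using int by simp
    show "(\<lambda>x. V x * (norm (u x))\<^sup>2) \<in> borel_measurable (lebesgue_on D)"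
      using V_meas um by measurable
    show "AE x in lebesgue_on D. norm (V x * (norm (u x))\<^sup>2) \<le> norm (W * (norm (u x))\<^sup>2)"
      using V_bounds by eventually_elim (simp add: abs_mult mult_right_mono)
  qed
  show "integrable (lebesgue_on D) (\<lambda>x. \<beta> / 2 * trunc_F M (u x))"
  proof (rule integrable_mult_right, rule Bochner_Integration.integrable_bound)
    show "integrable (lebesgue_on D) (\<lambda>x. 17 * M\<^sup>2 * (norm (u x))\<^sup>2)" using int by simp
    show "(\<lambda>x. trunc_F M (u x)) \<in> borel_measurable (lebesgue_on D)"
      using um by measurable
    show "AE x in lebesgue_on D. norm (trunc_F M (u x)) \<le> norm (17 * M\<^sup>2 * (norm (u x))\<^sup>2)"
      using abs_trunc_F_le[OF M] by (intro AE_I2) simp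
  qed
  show "integrable (lebesgue_on D) (\<lambda>x. \<kappa> * (norm (u x))\<^sup>2)" using int by simp
qed

lemma potential_energy_tangent:
  assumes u: "u \<in> L2 D" and v: "v \<in> L2 D"
  shows "(LINT x|lebesgue_on D. potential_density V \<beta> \<kappa> M (v x) x)
       \<le> (LINT x|lebesgue_on D. potential_density V \<beta> \<kappa> M (u x) x)
          + Re (L2_inner D (\<lambda>x. potential_gradient V \<beta> \<kappa> M (u x) x) (\<lambda>x. v x - u x))"
proof -
  note int = L2_inner_integrable[OF potential_gradient_L2[OF u] L2_diff[OF v u]]
  have "(LINT x|lebesgue_on D. potential_density V \<beta> \<kappa> M (v x) x)
      \<le> (LINT x|lebesgue_on D. potential_density V \<beta> \<kappa> M (u x) x + Re (potential_gradient V \<beta> \<kappa> M (u x) x * cnj (v x - u x)))"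
  proof (rule integral_mono_AE)
    show "AE x in lebesgue_on D. potential_density V \<beta> \<kappa> M (v x) x
        \<le> potential_density V \<beta> \<kappa> M (u x) x + Re (potential_gradient V \<beta> \<kappa> M (u x) x * cnj (v x - u x))"
      using V_bounds by eventually_elim (simp only: potential_density_tangent)
  qed (intro Bochner_Integration.integrable_add potential_density_integrable u v integrable_Re int)+
  also have "\<dots> = (LINT x|lebesgue_on D. potential_density V \<beta> \<kappa> M (u x) x)
      + (LINT x|lebesgue_on D. Re (potential_gradient V \<beta> \<kappa> M (u x) x * cnj (v x - u x)))"
    by (intro Bochner_Integration.integral_add potential_density_integrable u integrable_Re int)
  also have "(LINT x|lebesgue_on D. Re (potential_gradient V \<beta> \<kappa> M (u x) x * cnj (v x - u x)))
      = Re (L2_inner D (\<lambda>x. potential_gradient V \<beta> \<kappa> M (u x) x) (\<lambda>x. v x - u x))"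
    unfolding L2_inner_def by (rule integral_Re[OF int])
  finally show ?thesis .
qed

end

section \<open>Descent of the energy\<close>

lemma Linfty_AE_bound:
  assumes "V \<in> Linfty D"
  shows "AE x in lebesgue_on D. \<bar>V x\<bar> \<le> Linfty_norm D V"
proof -
  let ?E = "esssup (lebesgue_on D) (\<lambda>x. ereal \<bar>V x\<bar>)"
  have fin: "?E < \<infinity>" using assms by (simp add: Linfty_def)
  have "AE x in lebesgue_on D. ereal \<bar>V x\<bar> \<le> ?E"
    by (rule esssup_AE)
  then show ?thesis
    by eventually_elim (use fin in \<open>cases ?E; simp add: Linfty_norm_def\<close>)
qed

text \<open>Up to sign, the iterate before normalization is the \<open>L\<^sup>2\<close> gradient of the energy.\<close>
lemma pre_iterate_eq:
  "pre_iterate D T V \<beta> \<kappa> \<tau> u x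
     = of_real (1 / \<tau>) * T \<tau> u x - potential_gradient V \<beta> \<kappa> (trunc_M D \<beta> V) (u x) x"
  by (simp add: pre_iterate_def potential_gradient_def algebra_simps)

text \<open>By Cauchy--Schwarz, \<open>Re \<langle>g, w\<rangle> \<le> \<parallel>g\<parallel>\<close> on the unit ball, with equality at \<open>g / \<parallel>g\<parallel>\<close>. If
  \<open>g\<close> is null, the quotient is \<open>0\<close> and both inner products vanish; this is why the unit ball appears
  instead of the unit sphere.\<close>
lemma L2_unit_maximizes_inner:
  assumes g: "g \<in> L2 D" and u: "u \<in> L2 D" "L2_norm D u \<le> 1" and v: "v \<in> L2 D"
    and v_eq: "AE x in lebesgue_on D. v x = g x / of_real (L2_norm D g)"
  shows "L2_norm D v \<le> 1" and "0 \<le> Re (L2_inner D g (\<lambda>x. v x - u x))"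
proof -
  define N where "N = L2_norm D g"
  have N: "0 \<le> N" by (simp add: N_def L2_norm_nonneg)
  have v_eq': "AE x in lebesgue_on D. v x = of_real (1 / N) * g x"
    using v_eq by (simp add: N_def)
  have cg: "(\<lambda>x. of_real (1 / N) * g x) \<in> L2 D" by (rule L2_cmult[OF g])
  have "L2_norm D v = 1 / N * N"
    using L2_norm_cong[OF v_eq' v cg] N by (simp add: L2_norm_cmult N_def norm_divide del: of_real_divide)
  then show "L2_norm D v \<le> 1" by (cases "N = 0") auto
  have "L2_inner D v g = L2_inner D (\<lambda>x. of_real (1 / N) * g x + 0) g"
    using L2_inner_cong[OF v_eq' v cg g] by simp
  also have "\<dots> = of_real (1 / N * N\<^sup>2)"
    by (subst L2_inner_lincomb_left[OF g L2_zero g]) (simp add: L2_inner_self N_def L2_inner_def)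
  finally have vg: "Re (L2_inner D v g) = N"
    by (cases "N = 0") (simp_all add: power2_eq_square)
  have ug: "Re (L2_inner D u g) \<le> N"
    using Re_L2_inner_le[OF u(1) g] mult_right_mono[OF u(2) N] by (simp add: N_def)
  have "Re (L2_inner D g (\<lambda>x. v x - u x)) = Re (L2_inner D v g) - Re (L2_inner D u g)"
    unfolding L2_inner_commute[of D g] by (simp add: L2_inner_diff_left[OF v u(1) g])
  then show "0 \<le> Re (L2_inner D g (\<lambda>x. v x - u x))"
    using vg ug by simp
qed

text \<open>Adding the tangent inequalities of the heat part and of the potential part gives
  \<open>E(v) \<le> E(u) - Re \<langle>g, v - u\<rangle>\<close>, where \<open>g\<close> is the iterate before normalization, and \<open>v = g / \<parallel>g\<parallel>\<close> maximizes
  \<open>Re \<langle>g, \<cdot>\<rangle>\<close> over the unit ball. The first two conclusions allow the step to be repeated.\<close>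
lemma trunc_energy_descent:
  fixes a b :: "'a::euclidean_space"
  assumes ab: "\<forall>i\<in>Basis. a \<bullet> i < b \<bullet> i" and T: "heat_semigroup a b T"
    and \<tau>: "0 < \<tau>" and \<beta>: "0 < \<beta>" and V: "V \<in> Linfty (box a b)"
    and V_nonneg: "AE x in lebesgue_on (box a b). 0 \<le> V x"
    and \<kappa>: "Linfty_norm (box a b) V + 3 * \<beta> * (trunc_M (box a b) \<beta> V)\<^sup>2 \<le> \<kappa>"
    and u: "u \<in> L2 (box a b)" "L2_norm (box a b) u \<le> 1"
    and v_eq: "AE x in lebesgue_on (box a b). v x = pre_iterate (box a b) T V \<beta> \<kappa> \<tau> u x
                / of_real (L2_norm (box a b) (pre_iterate (box a b) T V \<beta> \<kappa> \<tau> u))"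
  shows "v \<in> L2 (box a b)" and "L2_norm (box a b) v \<le> 1"
    and "trunc_energy (box a b) T V \<beta> \<kappa> \<tau> v \<le> trunc_energy (box a b) T V \<beta> \<kappa> \<tau> u"
proof -
  define D where "D = box a b"
  define M where "M = trunc_M D \<beta> V"
  define W where "W = Linfty_norm D V"
  define g where "g = pre_iterate D T V \<beta> \<kappa> \<tau> u"
  define P where "P = potential_density V \<beta> \<kappa> M"
  define G where "G = potential_gradient V \<beta> \<kappa> M"
  have Dm: "D \<in> sets lebesgue" by (simp add: D_def)
  have uD: "u \<in> L2 D" "L2_norm D u \<le> 1" using u by (simp_all add: D_def)
  have op: "L2_operator D (T t)" if "0 \<le> t" for t
    using T that by (auto simp: heat_semigroup_def D_def intro: C0_semigroup_operator)
  have V_meas: "V \<in> borel_measurable (lebesgue_on D)"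
    using V by (simp add: Linfty_def D_def)
  have V_bounds: "AE x in lebesgue_on D. 0 \<le> V x \<and> V x \<le> W"
    using V_nonneg Linfty_AE_bound[OF V] unfolding D_def W_def by eventually_elim simp
  have M: "0 \<le> M"
    using \<beta> integral_nonneg_AE[OF V_nonneg] by (simp add: M_def trunc_M_def D_def)
  have \<beta>0: "0 \<le> \<beta>" using \<beta> by simp
  have \<kappa>': "W + 3 * \<beta> * M\<^sup>2 \<le> \<kappa>" using \<kappa> by (simp add: W_def M_def D_def)
  note ctx = V_meas V_bounds \<beta>0 M \<kappa>'
  have G_L2: "(\<lambda>x. G (u x) x) \<in> L2 D"
    unfolding G_def by (rule potential_gradient_L2[OF ctx uD(1)])
  have Tu: "T \<tau> u \<in> L2 D"
    using L2_operator_closed[OF op uD(1)] \<tau> by simp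
  have g_eq: "g = (\<lambda>x. of_real (1 / \<tau>) * T \<tau> u x - G (u x) x)"
    unfolding g_def G_def M_def by (rule ext) (rule pre_iterate_eq)
  have g: "g \<in> L2 D"
    unfolding g_eq by (intro L2_diff L2_cmult Tu G_L2)
  have v_eq': "AE x in lebesgue_on D. v x = g x / of_real (L2_norm D g)"
    using v_eq unfolding g_def D_def .
  have "(\<lambda>x. inverse (of_real (L2_norm D g)) * g x) \<in> L2 D"
    by (rule L2_cmult[OF g])
  then have v: "v \<in> L2 D"
    by (rule L2_AE_cong[OF Dm]) (use v_eq' in \<open>simp add: divide_inverse mult.commute\<close>)
  then show "v \<in> L2 (box a b)" by (simp add: D_def)
  note unit = L2_unit_maximizes_inner[OF g uD v v_eq']
  show "L2_norm (box a b) v \<le> 1"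
    using unit(1) by (simp add: D_def)
  define w where "w = (\<lambda>x. v x - u x)"
  have w: "w \<in> L2 D" unfolding w_def by (rule L2_diff[OF v uD(1)])
  have energy: "trunc_energy D T V \<beta> \<kappa> \<tau> z = 1 / (2 * \<tau>) + \<kappa>
      - 1 / (2 * \<tau>) * (L2_norm D (T (\<tau> / 2) z))\<^sup>2 + (LINT x|lebesgue_on D. P (z x) x)" if z: "z \<in> L2 D" for z
  proof -
    have "trunc_energy D T V \<beta> \<kappa> \<tau> z = 1 / (2 * \<tau>)
        + (LINT x|lebesgue_on D. - (1 / (2 * \<tau>)) * (norm (T (\<tau> / 2) z x))\<^sup>2 + P (z x) x) + \<kappa>"
      unfolding trunc_energy_def P_def potential_density_def M_def by (simp add: algebra_simps)
    also have "(LINT x|lebesgue_on D. - (1 / (2 * \<tau>)) * (norm (T (\<tau> / 2) z x))\<^sup>2 + P (z x) x)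
        = (LINT x|lebesgue_on D. - (1 / (2 * \<tau>)) * (norm (T (\<tau> / 2) z x))\<^sup>2) + (LINT x|lebesgue_on D. P (z x) x)"
      unfolding P_def
      by (intro Bochner_Integration.integral_add integrable_mult_right L2_integrable_norm_sq
            L2_operator_closed[OF op] potential_density_integrable[OF ctx] z) (use \<tau> in simp)
    also have "(LINT x|lebesgue_on D. - (1 / (2 * \<tau>)) * (norm (T (\<tau> / 2) z x))\<^sup>2)
        = - (1 / (2 * \<tau>)) * (L2_norm D (T (\<tau> / 2) z))\<^sup>2"
      unfolding L2_norm_power2 by (rule integral_mult_right_zero)
    finally show ?thesis by simp
  qed
  have kinetic: "(L2_norm D (T (\<tau> / 2) u))\<^sup>2 + 2 * Re (L2_inner D (T \<tau> u) w) \<le> (L2_norm D (T (\<tau> / 2) v))\<^sup>2"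
    unfolding D_def w_def using heat_energy_lower[OF ab T \<tau>] uD(1) v by (simp add: D_def)
  have "1 / (2 * \<tau>) * ((L2_norm D (T (\<tau> / 2) u))\<^sup>2 + 2 * Re (L2_inner D (T \<tau> u) w))
      \<le> 1 / (2 * \<tau>) * (L2_norm D (T (\<tau> / 2) v))\<^sup>2"
    using \<tau> by (intro mult_left_mono kinetic) simp
  then have kinetic': "1 / (2 * \<tau>) * (L2_norm D (T (\<tau> / 2) u))\<^sup>2 + 1 / \<tau> * Re (L2_inner D (T \<tau> u) w)
      \<le> 1 / (2 * \<tau>) * (L2_norm D (T (\<tau> / 2) v))\<^sup>2"
    by (simp add: distrib_left)
  have potential: "(LINT x|lebesgue_on D. P (v x) x)
      \<le> (LINT x|lebesgue_on D. P (u x) x) + Re (L2_inner D (\<lambda>x. G (u x) x) w)"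
    unfolding P_def G_def w_def by (rule potential_energy_tangent[OF ctx uD(1) v])
  have "L2_inner D g w = L2_inner D (\<lambda>x. of_real (1 / \<tau>) * T \<tau> u x) w - L2_inner D (\<lambda>x. G (u x) x) w"
    unfolding g_eq by (rule L2_inner_diff_left[OF L2_cmult[OF Tu] G_L2 w])
  also have "L2_inner D (\<lambda>x. of_real (1 / \<tau>) * T \<tau> u x) w = of_real (1 / \<tau>) * L2_inner D (T \<tau> u) w"
    using L2_inner_lincomb_left[OF Tu L2_zero w] by (simp add: L2_inner_def)
  finally have "Re (L2_inner D g w) = 1 / \<tau> * Re (L2_inner D (T \<tau> u) w) - Re (L2_inner D (\<lambda>x. G (u x) x) w)"
    by simp
  then have "trunc_energy D T V \<beta> \<kappa> \<tau> v \<le> trunc_energy D T V \<beta> \<kappa> \<tau> u"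
    unfolding energy[OF uD(1)] energy[OF v]
    using kinetic' potential unit(2)[folded w_def] by linarith
  then show "trunc_energy (box a b) T V \<beta> \<kappa> \<tau> v \<le> trunc_energy (box a b) T V \<beta> \<kappa> \<tau> u"
    by (simp add: D_def)
qed

theorem theorem2p9:
  fixes a b :: "'a::euclidean_space"
    and T :: "real \<Rightarrow> ('a \<Rightarrow> complex) \<Rightarrow> 'a \<Rightarrow> complex"
    and V :: "'a \<Rightarrow> real" and \<tau> \<beta> \<kappa> :: real
    and \<phi> :: "nat \<Rightarrow> 'a \<Rightarrow> complex"
  assumes "DIM('a) \<in> {1, 2, 3}"
    and "\<forall>i\<in>Basis. a \<bullet> i < b \<bullet> i"
    and "heat_semigroup a b T"
    and "\<tau> > 0" and "\<beta> > 0"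
    and "V \<in> Linfty (box a b)"
    and "AE x in lebesgue_on (box a b). V x \<ge> 0"
    and "\<kappa> \<ge> Linfty_norm (box a b) V + 3 * \<beta> * (trunc_M (box a b) \<beta> V)\<^sup>2"
    and "\<phi> 0 \<in> L2 (box a b)" and "L2_norm (box a b) (\<phi> 0) = 1"
    and "\<forall>n. AE x in lebesgue_on (box a b).
           \<phi> (Suc n) x =
             pre_iterate (box a b) T V \<beta> \<kappa> \<tau> (\<phi> n) x
             / complex_of_real (L2_norm (box a b) (pre_iterate (box a b) T V \<beta> \<kappa> \<tau> (\<phi> n)))"
  shows "\<forall>n. trunc_energy (box a b) T V \<beta> \<kappa> \<tau> (\<phi> (Suc n))
             \<le> trunc_energy (box a b) T V \<beta> \<kappa> \<tau> (\<phi> n)"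
proof
  fix n
  note step = trunc_energy_descent[OF assms(2-8) _ _ assms(11)[rule_format]]
  have "\<phi> n \<in> L2 (box a b) \<and> L2_norm (box a b) (\<phi> n) \<le> 1"
  proof (induction n)
    case 0
    then show ?case using assms(9,10) by simp
  next
    case (Suc n)
    then show ?case using step(1,2) by blast
  qed
  then show "trunc_energy (box a b) T V \<beta> \<kappa> \<tau> (\<phi> (Suc n)) \<le> trunc_energy (box a b) T V \<beta> \<kappa> \<tau> (\<phi> n)"
    using step(3) by blast
qed

end
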